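(* Let $N$ be a positive integer and let $A\in\mathbb{Z}$ satisfy $\gcd(A,N)=1$. Then the set $\{p\in\mathbb{P} : N\mid (p-A)\}$ is equinumerous with $\mathbb{N}$ (that is, there is a bijection between this set and $\mathbb{N}$; in particular there are infinitely many primes $p\equiv A\pmod N$).
   Context: $\mathbb{P}$ denotes the set of (positive) prime numbers. $\mathbb{N}$ denotes the set of positive integers. *)

theory Defs
  imports
    "HOL-Computational_Algebra.Primes"
    "HOL-Number_Theory.Cong"
    "HOL-Library.Equipollence"
begin

end

theory Submission
  imports Defs "HOL-Number_Theory.Number_Theory" "HOL-Analysis.Analysis" "HOL-Real_Asymp.Real_Asymp"
begin

text \<open>For a character \<open>\<psi>\<close> modulo \<open>N\<close> and real \<open>s > 1\<close> let \<open>L(s,\<psi>) = \<Sum> \<psi>(n) n\<^sup>-\<^sup>s\<close>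
  and \<open>F(s,\<psi>) = \<Sum> \<psi>(n) \<Lambda>(n) n\<^sup>-\<^sup>s\<close> with von Mangoldt's function \<open>\<Lambda>\<close>, so that
  \<open>L F = -L'\<close>. By orthogonality a combination of the \<open>F(s,\<psi>)\<close> equals a multiple of
  the sum of \<open>\<Lambda>(n) n\<^sup>-\<^sup>s\<close> over \<open>n\<close> in the given residue class. As \<open>s\<close> decreases to 1,
  the principal term tends to infinity, while the others stay bounded: \<open>L'\<close> is bounded by
  partial summation, and \<open>L(1,\<psi>)\<close> is nonzero. For nonreal \<open>\<psi>\<close> the latter holds since
  the modulus of the product of all \<open>L(s,\<psi>)\<close> is nonincreasing in \<open>s\<close>, so at most one factor
  can vanish at 1. For real \<open>\<psi>\<close> we use Monsky's argument with the Lambert series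
  \<open>\<Sum> \<psi>(n) t\<^sup>n / (1 - t\<^sup>n)\<close>, whose power series coefficients \<open>\<Sum>d | n. \<psi>(d)\<close> are
  nonnegative, and at least 1 at squares. Prime powers with exponent at least 2 contribute only a
  bounded amount, so infinitely many primes remain.\<close>

section \<open>Characters modulo \<open>N\<close>\<close>

text \<open>The obstacle is a possible zero of \<open>L\<close> at 1. A nonreal
  \<open>\<psi>\<close> vanishes at 1 together with its conjugate, and two zeros outweigh the simple
  pole of the principal factor. For a real \<open>\<psi>\<close> the two coincide, and a single zero
  could just cancel the pole; hence the separate argument, in which the size of the coefficients at
  squares contradicts a bound that the zero would imply. All analysis uses real \<open>s\<close>:
  monotonicity of the product on \<open>s > 1\<close> replaces analytic continuation, and at 1 only
  an upper bound for the pole and a Lipschitz estimate are needed. Orthogonality rests on having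
  enough characters. They come from extending characters of subgroups one generator at a time, with
  a free choice of root at each step, instead of decomposing the group of units. The residue class
  of \<open>A\<close> is described through an inverse \<open>b\<close>, as the \<open>n\<close> with
  \<open>b * n\<close> congruent to 1, so that \<open>\<psi> b * \<psi> n = \<psi> (b * n)\<close>
  and the sums over characters need no conjugates.\<close>

definition dchars :: "nat \<Rightarrow> (nat \<Rightarrow> complex) set" where
  "dchars N = {\<psi>. \<psi> 1 = 1 \<and> (\<forall>m n. \<psi> (m * n) = \<psi> m * \<psi> n) \<and>
     (\<forall>m n. [m = n] (mod N) \<longrightarrow> \<psi> m = \<psi> n) \<and> (\<forall>n. \<psi> n \<noteq> 0 \<longleftrightarrow> coprime n N)}"

definition principal_char :: "nat \<Rightarrow> nat \<Rightarrow> complex" where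
  "principal_char N n = (if coprime n N then 1 else 0)"

text \<open>A character on a subgroup of the units modulo \<open>N\<close>, the subgroup being given as a
  congruence-invariant set of natural numbers. Closure under inverses is automatic by
  Euler's theorem.\<close>

definition partial_char :: "nat \<Rightarrow> nat set \<Rightarrow> (nat \<Rightarrow> complex) \<Rightarrow> bool" where
  "partial_char N H \<psi> \<longleftrightarrow> 1 \<in> H \<and> \<psi> 1 = 1 \<and> (\<forall>n\<in>H. coprime n N) \<and>
     (\<forall>m\<in>H. \<forall>n\<in>H. m * n \<in> H \<and> \<psi> (m * n) = \<psi> m * \<psi> n) \<and>
     (\<forall>m\<in>H. \<forall>n. [m = n] (mod N) \<longrightarrow> n \<in> H \<and> \<psi> n = \<psi> m)"

section \<open>Extending characters from subgroups of the units\<close>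

lemma partial_charD:
  assumes "partial_char N H \<psi>"
  shows "1 \<in> H" "\<psi> 1 = 1" "n \<in> H \<Longrightarrow> coprime n N"
    "m \<in> H \<Longrightarrow> n \<in> H \<Longrightarrow> m * n \<in> H"
    "m \<in> H \<Longrightarrow> n \<in> H \<Longrightarrow> \<psi> (m * n) = \<psi> m * \<psi> n"
    "m \<in> H \<Longrightarrow> [m = n] (mod N) \<Longrightarrow> n \<in> H"
    "m \<in> H \<Longrightarrow> [m = n] (mod N) \<Longrightarrow> \<psi> n = \<psi> m"
  using assms unfolding partial_char_def by blast+

lemma partial_char_power:
  assumes "partial_char N H \<psi>" "m \<in> H"
  shows "m ^ k \<in> H \<and> \<psi> (m ^ k) = \<psi> m ^ k"
  by (induction k)
    (use partial_charD(1,2,4,5)[OF assms(1)] assms(2) in \<open>simp_all add: One_nat_def[symmetric] del: One_nat_def\<close>)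

text \<open>Dividing by \<open>h\<close> amounts to multiplying by
  \<open>h ^ (totient N - 1)\<close>, an inverse of \<open>h\<close> modulo \<open>N\<close> that
  lies in \<open>H\<close>.\<close>

lemma partial_char_division:
  assumes "partial_char N H \<psi>" "h \<in> H" "h * x \<in> H"
  shows "x \<in> H"
proof -
  have cop: "coprime h N" using partial_charD(3)[OF assms(1,2)] .
  \<comment> \<open>Only 1 is coprime to 0, so here \<open>h = 1\<close>.\<close>
  have "x \<in> H" if "N = 0"
    using that cop assms(3) by simp
  moreover have "x \<in> H" if "N > 0"
  proof -
    have *: "[h ^ totient N = 1] (mod N)" using euler_theorem[OF cop] .
    have "totient N > 0" using that by simp
    then have e: "h ^ totient N = h ^ (totient N - 1) * h"
      by (metis power_minus_mult)
    have "h ^ (totient N - 1) * (h * x) \<in> H"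
      using partial_charD(4)[OF assms(1)] partial_char_power[OF assms(1,2)] assms(3) by blast
    then have "h ^ totient N * x \<in> H" by (simp only: e mult.assoc)
    moreover have "[h ^ totient N * x = 1 * x] (mod N)"
      using * by (rule cong_mult) simp
    ultimately show ?thesis using partial_charD(6)[OF assms(1)] by fastforce
  qed
  ultimately show ?thesis by blast
qed

text \<open>Division with remainder: \<open>g ^ (j mod m)\<close> lies in \<open>H\<close> as a
  quotient of elements of \<open>H\<close>, so minimality of \<open>m\<close> makes the remainder 0.
  Thus \<open>m\<close> acts as the order of \<open>g\<close> modulo \<open>H\<close>.\<close>

lemma partial_char_power_order_dvd:
  fixes g :: nat
  assumes "partial_char N H \<psi>" "g ^ m \<in> H" "m > 0"
    "\<And>j. 0 < j \<Longrightarrow> j < m \<Longrightarrow> g ^ j \<notin> H" "g ^ j \<in> H"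
  shows "m dvd j"
proof -
  have "g ^ j = (g ^ m) ^ (j div m) * g ^ (j mod m)"
    by (metis mult_div_mod_eq power_add power_mult)
  then have "g ^ (j mod m) \<in> H"
    using partial_char_division[OF assms(1)] partial_char_power[OF assms(1,2)] assms(5) by metis
  then have "j mod m = 0"
    using assms(3,4) by (metis bot_nat_0.not_eq_extremum mod_less_divisor)
  then show ?thesis by auto
qed

text \<open>The subgroup generated by \<open>H\<close> and \<open>g\<close> consists of the classes
  \<open>h * g ^ k\<close>, on which the value must be \<open>\<psi> h * z ^ k\<close>. The only
  constraint on \<open>z\<close> comes from the first power of \<open>g\<close> in \<open>H\<close>;
  the remaining freedom in \<open>z\<close> is what later separates elements.\<close>

lemma partial_char_extend:
  fixes g :: nat
  assumes pc: "partial_char N H \<psi>" and g: "coprime g N" and m: "m > 0" "g ^ m \<in> H"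
    and least: "\<And>j. 0 < j \<Longrightarrow> j < m \<Longrightarrow> g ^ j \<notin> H" and z: "z ^ m = \<psi> (g ^ m)"
  shows "\<exists>H' \<psi>'. partial_char N H' \<psi>' \<and> H \<subseteq> H' \<and> g \<in> H' \<and> \<psi>' g = z \<and>
    (\<forall>n\<in>H. \<psi>' n = \<psi> n)"
proof -
  define R where "R = (\<lambda>x h k. h \<in> H \<and> [x = h * g ^ k] (mod N))"
  define H' where "H' = {x. \<exists>h k. R x h k}"
  define \<psi>' where "\<psi>' x = (SOME v. \<exists>h k. R x h k \<and> v = \<psi> h * z ^ k)" for x
  \<comment> \<open>Cancelling \<open>g ^ k\<close> from two representations of \<open>x\<close>
    puts \<open>g ^ j\<close> into \<open>H\<close>, where \<open>j\<close> is the difference of the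
    exponents. Then \<open>m\<close> divides \<open>j\<close>, and
    \<open>z ^ j = \<psi> (g ^ j)\<close> follows from the equation for \<open>z\<close>.\<close>
  have wd1: "\<psi> h * z ^ k = \<psi> h' * z ^ k'" if "R x h k" "R x h' k'" "k \<le> k'" for x h k h' k'
  proof -
    obtain j where j: "k' = k + j" using \<open>k \<le> k'\<close> le_Suc_ex by blast
    have "[h * g ^ k = h' * g ^ j * g ^ k] (mod N)"
      using cong_trans[OF cong_sym, of x "h * g ^ k" N "h' * g ^ k'"] that
      unfolding R_def j by (simp add: power_add mult_ac)
    then have c: "[h = h' * g ^ j] (mod N)"
      using g by (simp add: cong_mult_rcancel_nat coprime_power_left_iff)
    have h: "h \<in> H" "h' \<in> H" using that by (auto simp: R_def)
    have in': "h' * g ^ j \<in> H" and eq: "\<psi> (h' * g ^ j) = \<psi> h"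
      using partial_charD(6,7)[OF pc h(1) c] by auto
    have gj: "g ^ j \<in> H" using partial_char_division[OF pc h(2) in'] .
    then obtain q where q: "j = m * q"
      using partial_char_power_order_dvd[OF pc m(2,1) least] by auto
    have "\<psi> h = \<psi> h' * \<psi> (g ^ j)" using eq partial_charD(5)[OF pc h(2) gj] by simp
    also have "\<psi> (g ^ j) = z ^ j"
      using partial_char_power[OF pc m(2), of q] z by (simp add: q power_mult)
    finally show ?thesis by (simp add: j power_add mult_ac)
  qed
  have wd: "\<psi> h * z ^ k = \<psi> h' * z ^ k'" if "R x h k" "R x h' k'" for x h k h' k'
    using wd1[OF that] wd1[OF that(2,1)] by (metis nle_le)
  have val: "\<psi>' x = \<psi> h * z ^ k" if "R x h k" for x h k
  proof -
    have "\<exists>v h k. R x h k \<and> v = \<psi> h * z ^ k" using that by blast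
    then have "\<exists>h k. R x h k \<and> \<psi>' x = \<psi> h * z ^ k"
      unfolding \<psi>'_def by (rule someI_ex)
    then show ?thesis using wd that by metis
  qed
  have Rmult: "R (x * y) (h * h') (k + k')" if "R x h k" "R y h' k'" for x y h h' k k'
  proof -
    have "[x * y = (h * g ^ k) * (h' * g ^ k')] (mod N)"
      using that unfolding R_def by (auto intro: cong_mult)
    then show ?thesis
      using that partial_charD(4)[OF pc] unfolding R_def by (auto simp: power_add mult_ac)
  qed
  have R1: "R h h 0" if "h \<in> H" for h using that by (simp add: R_def)
  have Rg: "R g 1 1" using partial_charD(1)[OF pc] by (simp add: R_def)
  have Rc: "R y h k" if "R x h k" "[x = y] (mod N)" for x y h k
    using that unfolding R_def by (metis cong_sym cong_trans)
  have "partial_char N H' \<psi>'"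
    unfolding partial_char_def
  proof (intro conjI ballI allI impI)
    show "1 \<in> H'" using R1[OF partial_charD(1)[OF pc]] by (auto simp: H'_def)
    show "\<psi>' 1 = 1" using val[OF R1[OF partial_charD(1)[OF pc]]] partial_charD(2)[OF pc] by simp
    show "coprime n N" if n: "n \<in> H'" for n
    proof -
      obtain h k where hk: "h \<in> H" "[n = h * g ^ k] (mod N)"
        using n by (auto simp: H'_def R_def)
      have "coprime (h * g ^ k) N" using partial_charD(3)[OF pc hk(1)] g by simp
      then show ?thesis using hk(2) by (metis cong_imp_coprime cong_sym)
    qed
    fix x y assume x: "x \<in> H'" and y: "y \<in> H'"
    then obtain h k h' k' where *: "R x h k" "R y h' k'" by (auto simp: H'_def)
    show "x * y \<in> H'" using Rmult[OF *] by (auto simp: H'_def)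
    have "\<psi>' (x * y) = \<psi> (h * h') * z ^ (k + k')" using val[OF Rmult[OF *]] .
    also have "\<psi> (h * h') = \<psi> h * \<psi> h'" using * partial_charD(5)[OF pc] by (auto simp: R_def)
    finally show "\<psi>' (x * y) = \<psi>' x * \<psi>' y" using val *
      by (simp add: power_add)
  next
    fix x y assume x: "x \<in> H'" and "[x = y] (mod N)"
    then obtain h k where *: "R x h k" "R y h k" using Rc by (auto simp: H'_def)
    show "y \<in> H'" using * by (auto simp: H'_def)
    show "\<psi>' y = \<psi>' x" using val * by simp
  qed
  moreover have "H \<subseteq> H'" using R1 by (auto simp: H'_def)
  moreover have "g \<in> H'" using Rg by (auto simp: H'_def)
  moreover have "\<psi>' g = z" using val[OF Rg] partial_charD(2)[OF pc] by simp
  moreover have "\<forall>n\<in>H. \<psi>' n = \<psi> n" using val[OF R1] by simp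
  ultimately show ?thesis by blast
qed

lemma dcharsD:
  assumes "\<psi> \<in> dchars N"
  shows "\<psi> 1 = 1" "\<psi> (m * n) = \<psi> m * \<psi> n" "[m = n] (mod N) \<Longrightarrow> \<psi> m = \<psi> n"
    "\<psi> n \<noteq> 0 \<longleftrightarrow> coprime n N"
  using assms unfolding dchars_def by blast+

lemma partial_char_totient_power:
  assumes pc: "partial_char N H \<psi>" and n: "coprime n N"
  shows "n ^ totient N \<in> H" "\<psi> (n ^ totient N) = 1"
  using partial_charD(1,2,6,7)[OF pc] cong_sym[OF euler_theorem[OF n]] by metis+

text \<open>For \<open>N > 0\<close> Euler's theorem makes the values on \<open>H\<close> roots of
  unity.\<close>

lemma partial_char_nonzero:
  assumes pc: "partial_char N H \<psi>" and n: "n \<in> H"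
  shows "\<psi> n \<noteq> 0"
proof (cases "N = 0")
  case True
  then have "n = 1" using n partial_charD(3)[OF pc, of n] by simp
  then show ?thesis using partial_charD(2)[OF pc] by simp
next
  case False
  have "\<psi> n ^ totient N = 1"
    using partial_char_power[OF pc n] partial_char_totient_power[OF pc partial_charD(3)[OF pc n]]
    by metis
  then show ?thesis using False by (metis power_0_left totient_0_iff zero_neq_one)
qed

lemma partial_char_full:
  assumes pc: "partial_char N H \<psi>" and full: "\<And>n. coprime n N \<Longrightarrow> n \<in> H"
  shows "(\<lambda>n. if n \<in> H then \<psi> n else 0) \<in> dchars N"
proof -
  have H: "n \<in> H \<longleftrightarrow> coprime n N" for n
    using full partial_charD(3)[OF pc] by blast
  show ?thesis
    unfolding dchars_def
  proof (intro CollectI conjI allI impI)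
    show "(if 1 \<in> H then \<psi> 1 else 0) = 1" using partial_charD(1,2)[OF pc] by simp
    fix m n
    show "(if m * n \<in> H then \<psi> (m * n) else 0) = (if m \<in> H then \<psi> m else 0) * (if n \<in> H then \<psi> n else 0)"
      using partial_charD(5)[OF pc, of m n] by (auto simp: H)
  next
    fix m n assume mn: "[m = n] (mod N)"
    then show "(if m \<in> H then \<psi> m else 0) = (if n \<in> H then \<psi> n else 0)"
      using partial_charD(6,7)[OF pc _ mn] partial_charD(6)[OF pc _ cong_sym[OF mn]] by auto
  next
    fix n
    show "((if n \<in> H then \<psi> n else 0) \<noteq> 0) = coprime n N"
      using partial_char_nonzero[OF pc, of n] H[of n] by simp
  qed
qed

lemma partial_char_extend_step:
  assumes N: "N > 0" and pc: "partial_char N H \<psi>" and g: "coprime g N"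
  shows "\<exists>H' \<psi>'. partial_char N H' \<psi>' \<and> H \<subseteq> H' \<and> g \<in> H' \<and> (\<forall>n\<in>H. \<psi>' n = \<psi> n)"
proof -
  define m where "m = (LEAST m. m > 0 \<and> g ^ m \<in> H)"
  have m: "m > 0 \<and> g ^ m \<in> H"
    unfolding m_def
    by (rule LeastI[of _ "totient N"]) (use N partial_char_totient_power(1)[OF pc g] in simp)
  have least: "g ^ j \<notin> H" if "0 < j" "j < m" for j
    using not_less_Least[of j "\<lambda>m. m > 0 \<and> g ^ m \<in> H"] that by (auto simp: m_def)
  \<comment> \<open>Some \<open>m\<close>-th root of a nonzero value, taken through the complex
    logarithm.\<close>
  define z where "z = exp (Ln (\<psi> (g ^ m)) / of_nat m)"
  have "z ^ m = \<psi> (g ^ m)"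
    using m partial_char_nonzero[OF pc, of "g ^ m"] by (simp add: z_def exp_of_nat_mult[symmetric])
  then show ?thesis
    using partial_char_extend[OF pc g, of m z] m least by blast
qed

text \<open>Induction on the number of residues below \<open>N\<close> outside the subgroup: every
  extension step adjoins at least one of them. At the end \<open>\<psi>\<close> is continued by
  0.\<close>

lemma partial_char_extends_to_dchar:
  assumes N: "N > 0" and "partial_char N H \<psi>"
  shows "\<exists>\<phi>\<in>dchars N. \<forall>n\<in>H. \<phi> n = \<psi> n"
  using assms(2)
proof (induction "card ({..<N} - H)" arbitrary: H \<psi> rule: less_induct)
  case less
  note pc = less.prems
  show ?case
  proof (cases "\<forall>n. coprime n N \<longrightarrow> n \<in> H")
    case True
    show ?thesis
      by (rule bexI[OF _ partial_char_full[OF pc]]) (use True in auto)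
  next
    case False
    then obtain g' where g': "coprime g' N" "g' \<notin> H" by blast
    \<comment> \<open>The missing element is reduced modulo \<open>N\<close> so that adjoining it
      lowers the induction measure.\<close>
    define g where "g = g' mod N"
    have cg: "[g' = g] (mod N)" by (simp add: g_def cong_def)
    have g: "coprime g N" "g \<notin> H" "g < N"
      using g' cong_imp_coprime[OF cg] partial_charD(6)[OF pc _ cong_sym[OF cg]] N
      by (auto simp: g_def)
    obtain H' \<psi>' where H': "partial_char N H' \<psi>'" "H \<subseteq> H'" "g \<in> H'" "\<forall>n\<in>H. \<psi>' n = \<psi> n"
      using partial_char_extend_step[OF N pc g(1)] by blast
    have "card ({..<N} - H') < card ({..<N} - H)"
      by (rule psubset_card_mono) (use H' g in auto)
    from less.hyps[OF this H'(1)] obtain \<phi> where "\<phi> \<in> dchars N" "\<forall>n\<in>H'. \<phi> n = \<psi>' n" by blast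
    then show ?thesis using H' by (metis subsetD)
  qed
qed

text \<open>Start from the trivial character on the class of 1. If \<open>a\<close> has order
  \<open>m\<close> modulo \<open>N\<close>, then \<open>m \<ge> 2\<close>, and the extension to
  \<open>a\<close> may take the value \<open>cis (2 * pi / m)\<close>, which differs from 1.\<close>

lemma dchars_separate:
  assumes N: "N > 0" and a: "coprime a N" "\<not> [a = 1] (mod N)"
  shows "\<exists>\<psi>\<in>dchars N. \<psi> a \<noteq> 1"
proof -
  define H where "H = {n. [n = 1] (mod N)}"
  have pc: "partial_char N H (\<lambda>_. 1)"
    unfolding partial_char_def
  proof (intro conjI ballI allI impI)
    fix m n assume "m \<in> H" "n \<in> H"
    then show "m * n \<in> H" using cong_mult[of m 1 N n 1] by (simp add: H_def)
  next
    fix m n assume "m \<in> H" "[m = n] (mod N)"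
    then show "n \<in> H" unfolding H_def using cong_sym cong_trans by blast
  next
    fix n assume "n \<in> H" then show "coprime n N"
      using cong_imp_coprime[of 1 n N] by (simp add: H_def cong_sym)
  qed (auto simp: H_def)
  define m where "m = (LEAST m. m > 0 \<and> a ^ m \<in> H)"
  have m: "m > 0 \<and> a ^ m \<in> H"
    unfolding m_def
    by (rule LeastI[of _ "totient N"]) (use N partial_char_totient_power(1)[OF pc a(1)] in simp)
  have least: "a ^ j \<notin> H" if "0 < j" "j < m" for j
    using not_less_Least[of j "\<lambda>m. m > 0 \<and> a ^ m \<in> H"] that by (auto simp: m_def)
  have "m \<noteq> 1" using m a(2) by (auto simp: H_def)
  then have m2: "m \<ge> 2" using m by linarith
  define z where "z = cis (2 * pi / real m)"
  have z: "z ^ m = 1" using m by (simp add: z_def Complex.DeMoivre)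
  have "z \<noteq> 1"
  proof
    assume "z = 1"
    then have "cos (2 * pi / real m) = 1" by (simp add: z_def complex_eq_iff)
    then obtain k :: int where k: "2 * pi / real m = of_int k * 2 * pi"
      using cos_one_2pi_int by auto
    then have "of_int k * real m = 1" using m by (simp add: field_simps)
    then have "k * int m = 1" by (metis of_int_1 of_int_eq_iff of_int_mult of_int_of_nat_eq)
    then show False using m2 by (auto simp: zmult_eq_1_iff)
  qed
  obtain H' \<psi>' where H': "partial_char N H' \<psi>'" "a \<in> H'" "\<psi>' a = z"
    using partial_char_extend[OF pc a(1), of m z] m least z by blast
  then show ?thesis using partial_char_extends_to_dchar[OF N H'(1)] \<open>z \<noteq> 1\<close> by metis
qed

section \<open>Values, finiteness and orthogonality\<close>

lemma dchars_power_totient: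
  assumes "\<psi> \<in> dchars N" "coprime n N"
  shows "\<psi> n ^ totient N = 1"
proof -
  have "\<psi> (n ^ k) = \<psi> n ^ k" for k
    by (induction k) (use dcharsD(1,2)[OF assms(1)] in simp_all)
  then show ?thesis
    using dcharsD(1,3)[OF assms(1)] euler_theorem[OF assms(2)] by metis
qed

lemma norm_dchars:
  assumes "N > 0" "\<psi> \<in> dchars N"
  shows "norm (\<psi> n) = (if coprime n N then 1 else 0)"
proof (cases "coprime n N")
  case True
  have "norm (\<psi> n) ^ totient N = 1"
    using dchars_power_totient[OF assms(2) True] by (metis norm_one norm_power)
  then have "norm (\<psi> n) = 1" using assms(1)
    by (metis norm_ge_zero power_eq_1_iff totient_0_iff not_gr_zero less_not_refl real_norm_def abs_norm_cancel)
  then show ?thesis using True by simp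
qed (use dcharsD(4)[OF assms(2), of n] in simp)

lemma norm_dchars_le:
  assumes "N > 0" "\<psi> \<in> dchars N"
  shows "norm (\<psi> n) \<le> 1"
  by (simp add: norm_dchars[OF assms])

text \<open>A character is determined by its values below \<open>N\<close>, each of which is 0 or a
  root of unity of bounded order.\<close>

lemma finite_dchars:
  assumes N: "N > 0"
  shows "finite (dchars N)"
proof -
  define S where "S = insert 0 {z::complex. z ^ totient N = 1}"
  have "finite S" using N by (simp add: S_def finite_roots_unity Suc_leI)
  then have "finite ({..<N} \<rightarrow>\<^sub>E S)" by (intro finite_PiE) auto
  moreover have "(\<lambda>\<psi>. restrict \<psi> {..<N}) ` dchars N \<subseteq> ({..<N} \<rightarrow>\<^sub>E S)"
  proof -
    have "\<psi> n \<in> S" if "\<psi> \<in> dchars N" for \<psi> n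
      using dchars_power_totient[OF that, of n] dcharsD(4)[OF that, of n] by (auto simp: S_def)
    then show ?thesis by (intro image_subsetI) (simp add: restrict_PiE_iff)
  qed
  moreover have "inj_on (\<lambda>\<psi>. restrict \<psi> {..<N}) (dchars N)"
  proof (rule inj_onI)
    fix \<psi> \<phi> assume *: "\<psi> \<in> dchars N" "\<phi> \<in> dchars N" "restrict \<psi> {..<N} = restrict \<phi> {..<N}"
    have "\<psi> n = \<phi> n" for n
    proof -
      have c: "[n = n mod N] (mod N)" by (simp add: Cong.cong_def)
      have "\<psi> (n mod N) = \<phi> (n mod N)"
        using fun_cong[OF *(3), of "n mod N"] N by simp
      then show ?thesis using dcharsD(3)[OF *(1) c] dcharsD(3)[OF *(2) c] by simp
    qed
    then show "\<psi> = \<phi>" by auto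
  qed
  ultimately show ?thesis using finite_imageD finite_subset by blast
qed

lemma principal_char_in_dchars [simp]: "principal_char N \<in> dchars N"
  unfolding dchars_def principal_char_def
  using cong_imp_coprime[of _ _ N] cong_imp_coprime[OF cong_sym, of _ _ N] by auto

lemma dchars_mult:
  assumes "\<psi> \<in> dchars N" "\<phi> \<in> dchars N"
  shows "(\<lambda>n. \<psi> n * \<phi> n) \<in> dchars N"
  using assms unfolding dchars_def by (auto simp: mult_ac)

lemma dchars_cnj:
  assumes "\<psi> \<in> dchars N"
  shows "(\<lambda>n. cnj (\<psi> n)) \<in> dchars N"
  using assms unfolding dchars_def by auto

lemma dchars_mult_cnj:
  assumes "N > 0" "\<psi> \<in> dchars N"
  shows "\<psi> n * cnj (\<psi> n) = principal_char N n"
  using norm_dchars[OF assms, of n] by (simp add: principal_char_def complex_norm_square[symmetric])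

lemma dchars_times_principal:
  assumes "\<psi> \<in> dchars N"
  shows "\<psi> n * principal_char N n = \<psi> n"
  using dcharsD(4)[OF assms, of n] by (auto simp: principal_char_def)

text \<open>Multiplication by a character \<open>\<phi>\<close> with
  \<open>\<phi> n \<noteq> 1\<close> permutes the characters, with multiplication by the conjugate
  as inverse. The sum is therefore unchanged by the factor \<open>\<phi> n\<close> and must
  vanish.\<close>

lemma dchars_orthogonality:
  assumes N: "N > 0"
  shows "(\<Sum>\<psi>\<in>dchars N. \<psi> n) = (if [n = 1] (mod N) then of_nat (card (dchars N)) else 0)"
proof (cases "[n = 1] (mod N)")
  case True
  then have "\<psi> n = 1" if "\<psi> \<in> dchars N" for \<psi>
    using dcharsD(1,3)[OF that] by metis
  then have "(\<Sum>\<psi>\<in>dchars N. \<psi> n) = (\<Sum>\<psi>\<in>dchars N. 1)" by (intro sum.cong) auto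
  then show ?thesis using True by simp
next
  case False
  have "(\<Sum>\<psi>\<in>dchars N. \<psi> n) = 0"
  proof (cases "coprime n N")
    case True
    then obtain \<phi> where \<phi>: "\<phi> \<in> dchars N" "\<phi> n \<noteq> 1"
      using dchars_separate[OF N _ False] by blast
    have "(\<Sum>\<psi>\<in>dchars N. \<psi> n) = (\<Sum>\<psi>\<in>dchars N. \<phi> n * \<psi> n)"
    proof (rule sum.reindex_bij_witness[of _ "\<lambda>\<psi> n. \<phi> n * \<psi> n" "\<lambda>\<psi> n. cnj (\<phi> n) * \<psi> n"])
      fix \<psi> assume \<psi>: "\<psi> \<in> dchars N"
      have *: "\<phi> k * (cnj (\<phi> k) * \<psi> k) = \<psi> k" "cnj (\<phi> k) * (\<phi> k * \<psi> k) = \<psi> k" for k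
        using dchars_mult_cnj[OF N \<phi>(1), of k] dchars_times_principal[OF \<psi>, of k]
        by (simp_all add: mult_ac)
      show "(\<lambda>n. \<phi> n * (cnj (\<phi> n) * \<psi> n)) = \<psi>" "(\<lambda>n. cnj (\<phi> n) * (\<phi> n * \<psi> n)) = \<psi>"
        "\<phi> n * (cnj (\<phi> n) * \<psi> n) = \<psi> n"
        using * by auto
      show "(\<lambda>n. \<phi> n * \<psi> n) \<in> dchars N" "(\<lambda>n. cnj (\<phi> n) * \<psi> n) \<in> dchars N"
        using dchars_mult dchars_cnj \<phi>(1) \<psi> by auto
    qed
    also have "\<dots> = \<phi> n * (\<Sum>\<psi>\<in>dchars N. \<psi> n)" by (simp add: sum_distrib_left)
    finally show ?thesis using \<phi>(2) by simp
  next
    case False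
    then show ?thesis using dcharsD(4) by (intro sum.neutral) auto
  qed
  then show ?thesis using False by simp
qed

lemma card_dchars_pos: "N > 0 \<Longrightarrow> card (dchars N) > 0"
  using finite_dchars principal_char_in_dchars card_gt_0_iff by blast

section \<open>Dirichlet series\<close>

text \<open>Pairs \<open>(d, e)\<close> are regrouped by their product \<open>d * e\<close>. This
  serves both the product of Dirichlet series and the Lambert series.\<close>

lemma has_sum_divisor_pairs:
  fixes f :: "nat \<times> nat \<Rightarrow> 'a :: banach"
  assumes "(f has_sum S) ({0<..} \<times> {0<..})"
  shows "((\<lambda>n. \<Sum>d | d dvd n. f (d, n div d)) has_sum S) {0<..}"
proof -
  have pos: "0 < d" "0 < n div d" if "0 < n" "d dvd n" for n d :: nat
    using that by (auto elim!: dvdE)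
  have *: "((\<lambda>(n, d). f (d, n div d)) has_sum S) (SIGMA n:{0<..}. {d. d dvd n})"
    using assms
  proof (rule has_sum_reindex_bij_witness[of _ "\<lambda>(d, e). (d * e, d)" "\<lambda>(n, d). (d, n div d)",
        THEN iffD2, rotated -1])
    fix p :: "nat \<times> nat" assume "p \<in> (SIGMA n:{0<..}. {d. d dvd n})"
    then show "(case p of (n, d) \<Rightarrow> (d, n div d)) \<in> {0<..} \<times> {0<..}"
      using pos by auto
  qed auto
  show ?thesis
    by (rule has_sum_SigmaD[OF *]) (auto intro!: has_sum_finiteI)
qed

lemma has_sum_Times_mult:
  fixes a :: "'b \<Rightarrow> 'a :: {real_normed_field, banach}" and b :: "'c \<Rightarrow> 'a"
  assumes a: "(\<lambda>d. norm (a d)) summable_on A" "(a has_sum S) A" and b: "(\<lambda>e. norm (b e)) summable_on B" "(b has_sum T) B"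
  shows "((\<lambda>(d, e). a d * b e) has_sum (S * T)) (A \<times> B)"
proof -
  have "(\<lambda>p. norm (case p of (d, e) \<Rightarrow> a d * b e)) summable_on A \<times> B"
    unfolding Infinite_Sum.abs_summable_on_Sigma_iff
  proof (intro conjI ballI)
    fix x assume "x \<in> A"
    show "(\<lambda>y. norm (case (x, y) of (d, e) \<Rightarrow> a d * b e)) summable_on B"
      using summable_on_cmult_right[OF b(1), of "norm (a x)"] by (simp add: norm_mult)
  next
    show "(\<lambda>x. norm (\<Sum>\<^sub>\<infinity>y\<in>B. norm (case (x, y) of (d, e) \<Rightarrow> a d * b e))) summable_on A"
      using summable_on_cmult_left[OF a(1), of "norm (\<Sum>\<^sub>\<infinity>y\<in>B. norm (b y))"]
      by (simp add: norm_mult infsum_cmult_right' abs_mult)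
  qed
  then have "(\<lambda>(d, e). a d * b e) summable_on A \<times> B"
    by (rule Infinite_Sum.abs_summable_summable)
  then obtain U where U: "((\<lambda>(d, e). a d * b e) has_sum U) (A \<times> B)"
    using summable_on_def by blast
  have "((\<lambda>d. a d * T) has_sum U) A"
    by (rule has_sum_SigmaD[OF U]) (use has_sum_cmult_right[OF b(2)] in auto)
  moreover have "((\<lambda>d. a d * T) has_sum (S * T)) A"
    by (rule has_sum_cmult_left[OF a(2)])
  ultimately show ?thesis using U has_sum_unique by blast
qed

text \<open>The term \<open>n = 0\<close> vanishes since \<open>0 powr x = 0\<close>. For \<open>s \<le> 1\<close> the value is meaningful only
  where the series converges, e.g. for nonprincipal characters and \<open>s > 0\<close>.\<close>

definition dser :: "(nat \<Rightarrow> complex) \<Rightarrow> real \<Rightarrow> complex" where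
  "dser f s = (\<Sum>n. f n * of_real (real n powr (- s)))"

text \<open>One growth class for the characters and for their products with \<open>mangoldt\<close>
  and \<open>ln\<close>, giving absolute convergence for \<open>s > 1\<close>. At 0 the bound is 1,
  as \<open>ln 0 = 0\<close>.\<close>

definition log_bounded :: "(nat \<Rightarrow> complex) \<Rightarrow> bool" where
  "log_bounded f \<longleftrightarrow> (\<forall>n. norm (f n) \<le> 1 + ln (real n))"

text \<open>The exponent \<open>(1 + s) / 2\<close> lies strictly between 1 and \<open>s\<close>;
  the gap absorbs every power of the logarithm.\<close>

lemma summable_ln_power_powr:
  assumes "s > 1"
  shows "summable (\<lambda>n. ln (real n) ^ k * real n powr (- s))"
proof (rule summable_comparison_test_bigo)
  show "summable (\<lambda>n. norm (real n powr (- (1 + s) / 2)))"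
    using summable_real_powr_iff[of "- (1 + s) / 2"] assms by simp
  show "(\<lambda>n. ln (real n) ^ k * real n powr (- s)) \<in> O(\<lambda>n. real n powr (- (1 + s) / 2))"
    using assms by real_asymp
qed

lemma summable_log_bounded:
  assumes "log_bounded f" "s > 1"
  shows "summable (\<lambda>n. norm (f n * of_real (real n powr (- s))))"
proof (rule summable_comparison_test)
  show "summable (\<lambda>n. ln (real n) ^ 0 * real n powr (- s) + ln (real n) ^ 1 * real n powr (- s))"
    by (intro summable_add summable_ln_power_powr assms)
  show "\<exists>M. \<forall>n\<ge>M. norm (norm (f n * of_real (real n powr (- s))))
          \<le> ln (real n) ^ 0 * real n powr (- s) + ln (real n) ^ 1 * real n powr (- s)"
  proof (intro exI[of _ 0] allI impI)
    fix n
    have "norm (f n) * real n powr - s \<le> (1 + ln (real n)) * real n powr (- s)"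
      using assms(1) by (intro mult_right_mono) (auto simp: log_bounded_def)
    then show "norm (norm (f n * of_real (real n powr (- s))))
          \<le> ln (real n) ^ 0 * real n powr (- s) + ln (real n) ^ 1 * real n powr (- s)"
      by (simp add: norm_mult algebra_simps)
  qed
qed

lemma dser_sums:
  assumes "log_bounded f" "s > 1"
  shows "(\<lambda>n. f n * of_real (real n powr (- s))) sums dser f s"
  unfolding dser_def using summable_norm_cancel[OF summable_log_bounded[OF assms]] by (rule summable_sums)

lemma dser_has_sum:
  assumes "log_bounded f" "s > 1"
  shows "((\<lambda>n. f n * of_real (real n powr (- s))) has_sum dser f s) {0<..}"
    "(\<lambda>n. norm (f n * of_real (real n powr (- s)))) summable_on {0<..}"
proof -
  have "((\<lambda>n. f n * of_real (real n powr (- s))) has_sum dser f s) UNIV"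
    using norm_summable_imp_has_sum[OF summable_log_bounded dser_sums] assms by blast
  then show "((\<lambda>n. f n * of_real (real n powr (- s))) has_sum dser f s) {0<..}"
    by (rule has_sum_cong_neutral[THEN iffD1, rotated -1]) auto
  have "(\<lambda>n. norm (f n * of_real (real n powr (- s)))) summable_on UNIV"
    using summable_log_bounded[OF assms] by (intro norm_summable_imp_summable_on) simp
  then show "(\<lambda>n. norm (f n * of_real (real n powr (- s)))) summable_on {0<..}"
    by (rule summable_on_subset_banach) simp
qed

lemma dser_mult:
  assumes "log_bounded f" "log_bounded g" "log_bounded h" "s > 1"
    and conv: "\<And>n. n > 0 \<Longrightarrow> (\<Sum>d | d dvd n. f d * g (n div d)) = h n"
  shows "dser f s * dser g s = dser h s"
proof -
  have "((\<lambda>n. \<Sum>d | d dvd n. (\<lambda>(d, e). (f d * of_real (real d powr (- s))) * (g e * of_real (real e powr (- s))))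
          (d, n div d)) has_sum (dser f s * dser g s)) {0<..}"
    by (intro has_sum_divisor_pairs has_sum_Times_mult dser_has_sum assms)
  moreover have "(\<Sum>d | d dvd n. (\<lambda>(d, e). (f d * of_real (real d powr (- s))) * (g e * of_real (real e powr (- s))))
          (d, n div d)) = h n * of_real (real n powr (- s))" if "n \<in> {0<..}" for n
  proof -
    have "(\<Sum>d | d dvd n. (\<lambda>(d, e). (f d * of_real (real d powr (- s))) * (g e * of_real (real e powr (- s))))
          (d, n div d)) = (\<Sum>d | d dvd n. f d * g (n div d) * of_real (real n powr (- s)))"
    proof (intro sum.cong refl)
      fix d assume "d \<in> {d. d dvd n}"
      then obtain e where e: "n = d * e" by auto
      then have "real n powr (- s) = real d powr (- s) * real e powr (- s)"
        by (simp add: powr_mult)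
      then show "(\<lambda>(d, e). (f d * of_real (real d powr (- s))) * (g e * of_real (real e powr (- s))))
          (d, n div d) = f d * g (n div d) * of_real (real n powr (- s))"
        using e that by simp
    qed
    then show ?thesis using conv that by (simp add: sum_distrib_right[symmetric])
  qed
  ultimately have "((\<lambda>n. h n * of_real (real n powr (- s))) has_sum (dser f s * dser g s)) {0<..}"
    by (rule has_sum_cong[THEN iffD1, rotated])
  then show ?thesis using dser_has_sum(1)[OF assms(3,4)] has_sum_unique by blast
qed

lemma log_bounded_if_norm_le_1: "(\<And>n. norm (f n) \<le> 1) \<Longrightarrow> log_bounded f"
  unfolding log_bounded_def
proof
  fix n assume *: "\<And>n. norm (f n) \<le> 1"
  have "ln (real n) \<ge> 0" by (cases "n = 0") auto
  then show "norm (f n) \<le> 1 + ln (real n)" using *[of n] by linarith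
qed

lemma log_bounded_if_norm_le_ln: "(\<And>n. norm (f n) \<le> ln (real n)) \<Longrightarrow> log_bounded f"
  unfolding log_bounded_def by (meson add_increasing order_trans zero_le_one order_refl le_add_same_cancel2)

text \<open>\<open>mangoldt n\<close> is one of the nonnegative terms of a divisor sum equal to
  \<open>ln n\<close>.\<close>

lemma mangoldt_le_ln: "(mangoldt n :: real) \<le> ln (real n)"
proof (cases "n = 0")
  case False
  have "(mangoldt n :: real) \<le> (\<Sum>d | d dvd n. mangoldt d)"
    using False by (intro member_le_sum) (auto intro: mangoldt_nonneg)
  then show ?thesis using mangoldt_sum[OF False, where 'a = real] by simp
qed auto

lemma log_bounded_dchars:
  assumes "N > 0" "\<psi> \<in> dchars N"
  shows "log_bounded \<psi>" "log_bounded (\<lambda>n. \<psi> n * mangoldt n)" "log_bounded (\<lambda>n. \<psi> n * ln (real n))"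
proof -
  have n: "norm (\<psi> n * of_real x) \<le> y" if "0 \<le> x" "x \<le> y" for x y n
    using mult_mono[OF norm_dchars_le[OF assms, of n] that(2)] that by (simp add: norm_mult)
  show "log_bounded \<psi>" by (intro log_bounded_if_norm_le_1 norm_dchars_le[OF assms])
  show "log_bounded (\<lambda>n. \<psi> n * mangoldt n)"
    using n[OF mangoldt_nonneg mangoldt_le_ln] by (intro log_bounded_if_norm_le_ln) (simp only: of_real_mangoldt)
  have "ln (real n) \<ge> 0" for n by (cases "n = 0") auto
  then show "log_bounded (\<lambda>n. \<psi> n * ln (real n))"
    using n by (intro log_bounded_if_norm_le_ln) simp
qed

text \<open>Complete multiplicativity pulls \<open>\<psi> n\<close> out of the divisor sum, leaving
  the identity that the values of \<open>mangoldt\<close> over the divisors of \<open>n\<close> add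
  up to \<open>ln n\<close>.\<close>

lemma dser_mangoldt:
  assumes "N > 0" "\<psi> \<in> dchars N" "s > 1"
  shows "dser \<psi> s * dser (\<lambda>n. \<psi> n * mangoldt n) s = dser (\<lambda>n. \<psi> n * ln (real n)) s"
proof -
  have "dser (\<lambda>n. \<psi> n * mangoldt n) s * dser \<psi> s = dser (\<lambda>n. \<psi> n * ln (real n)) s"
  proof (rule dser_mult)
    fix n :: nat assume n: "n > 0"
    have "(\<Sum>d | d dvd n. \<psi> d * mangoldt d * \<psi> (n div d)) = (\<Sum>d | d dvd n. \<psi> n * mangoldt d)"
    proof (intro sum.cong refl)
      fix d assume "d \<in> {d. d dvd n}"
      then have "\<psi> d * \<psi> (n div d) = \<psi> n"
        using dcharsD(2)[OF assms(2), of d "n div d"] by simp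
      then show "\<psi> d * mangoldt d * \<psi> (n div d) = \<psi> n * mangoldt d" by (simp add: mult_ac)
    qed
    also have "\<dots> = \<psi> n * ln (real n)"
      using mangoldt_sum[of n, where 'a = complex] n by (simp add: sum_distrib_left[symmetric])
    finally show "(\<Sum>d | d dvd n. \<psi> d * mangoldt d * \<psi> (n div d)) = \<psi> n * ln (real n)" .
  qed (use assms log_bounded_dchars in auto)
  then show ?thesis by (simp add: mult.commute)
qed

section \<open>Differentiation of Dirichlet series in a real variable\<close>

lemma has_vector_derivative_series:
  fixes f :: "nat \<Rightarrow> real \<Rightarrow> 'b::banach"
  assumes "convex S"
    and "\<And>n x. x \<in> S \<Longrightarrow> (f n has_vector_derivative f' n x) (at x within S)"
    and lim: "uniform_limit S (\<lambda>n x. \<Sum>i<n. f' i x) g' sequentially"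
    and "x0 \<in> S" "(\<lambda>n. f n x0) sums l"
  shows "\<exists>g. \<forall>x\<in>S. (\<lambda>n. f n x) sums g x \<and> (g has_vector_derivative g' x) (at x within S)"
  unfolding has_vector_derivative_def
proof (rule has_derivative_series[where x = x0 and l = l])
  show "(f n has_derivative (\<lambda>h. h *\<^sub>R f' n x)) (at x within S)" if "x \<in> S" for n x
    using assms(2)[OF that] by (simp add: has_vector_derivative_def)
  fix e :: real assume "e > 0"
  with lim have "\<forall>\<^sub>F n in sequentially. \<forall>x\<in>S. dist (\<Sum>i<n. f' i x) (g' x) < e"
    by (simp add: uniform_limit_iff)
  then show "\<forall>\<^sub>F n in sequentially. \<forall>x\<in>S. \<forall>h. norm ((\<Sum>i<n. h *\<^sub>R f' i x) - h *\<^sub>R g' x) \<le> e * norm h"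
  proof eventually_elim
    case (elim n)
    show ?case
    proof (intro ballI allI)
      fix x h assume "x \<in> S"
      have "(\<Sum>i<n. h *\<^sub>R f' i x) - h *\<^sub>R g' x = h *\<^sub>R ((\<Sum>i<n. f' i x) - g' x)"
        by (simp add: scaleR_sum_right scaleR_diff_right)
      then have "norm ((\<Sum>i<n. h *\<^sub>R f' i x) - h *\<^sub>R g' x) = \<bar>h\<bar> * dist (\<Sum>i<n. f' i x) (g' x)"
        by (simp add: dist_norm)
      also have "\<dots> \<le> \<bar>h\<bar> * e" using elim \<open>x \<in> S\<close> by (intro mult_left_mono) (auto simp: less_imp_le)
      finally show "norm ((\<Sum>i<n. h *\<^sub>R f' i x) - h *\<^sub>R g' x) \<le> e * norm h" by (simp add: mult.commute)
    qed
  qed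
qed (use assms in auto)

lemma has_real_derivative_nat_powr_minus:
  "((\<lambda>s. real n powr (- s)) has_real_derivative - ln (real n) * real n powr (- s)) (at s within A)"
proof (cases "n = 0")
  case False
  have "((\<lambda>s. exp (- s * ln (real n))) has_real_derivative - ln (real n) * exp (- s * ln (real n))) (at s within A)"
    by (auto intro!: derivative_eq_intros)
  then show ?thesis using False by (simp add: powr_def)
qed auto

text \<open>With \<open>a\<close> halfway between 1 and \<open>s\<close>, the differentiated series
  converges uniformly to the right of \<open>a\<close>, majorized by the terms
  \<open>ln n * n powr (- a)\<close>.\<close>

lemma dser_has_vector_derivative:
  assumes f: "\<And>n. norm (f n) \<le> 1" and s: "s > 1"
  shows "(dser f has_vector_derivative - dser (\<lambda>n. f n * ln (real n)) s) (at s)"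
proof -
  define a where "a = (1 + s) / 2"
  have a: "1 < a" "a < s" using s by (auto simp: a_def)
  have ln0: "ln (real n) \<ge> 0" for n by (cases "n = 0") auto
  have lb: "log_bounded f" "log_bounded (\<lambda>n. f n * ln (real n))"
    using f mult_left_le_one_le[OF ln0 norm_ge_zero f] ln0
    by (auto intro!: log_bounded_if_norm_le_1 log_bounded_if_norm_le_ln[of "\<lambda>n. f n * ln (real n)"] simp: norm_mult)
  have "\<exists>g. \<forall>x\<in>{a<..}. (\<lambda>n. f n * of_real (real n powr (- x))) sums g x \<and>
     (g has_vector_derivative - dser (\<lambda>n. f n * ln (real n)) x) (at x within {a<..})"
  proof (rule has_vector_derivative_series)
    show "((\<lambda>x. f n * of_real (real n powr (- x))) has_vector_derivative
        - (f n * ln (real n) * of_real (real n powr (- x)))) (at x within {a<..})" for n x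
    proof -
      have "((\<lambda>x. f n * of_real (real n powr (- x))) has_vector_derivative
        f n * of_real (- ln (real n) * real n powr (- x))) (at x within {a<..})"
        by (intro has_vector_derivative_mult_right has_vector_derivative_of_real
            has_real_derivative_nat_powr_minus)
      then show ?thesis by (simp add: mult.assoc)
    qed
    have lim: "uniform_limit {a<..} (\<lambda>n x. \<Sum>i<n. - (f i * ln (real i) * of_real (real i powr (- x))))
       (\<lambda>x. \<Sum>i. - (f i * ln (real i) * of_real (real i powr (- x)))) sequentially"
    proof (rule Weierstrass_m_test)
      show "summable (\<lambda>n. ln (real n) ^ 1 * real n powr (- a))"
        by (rule summable_ln_power_powr[OF a(1)])
      fix n x assume x: "x \<in> {a<..}"
      have "real n powr (- x) \<le> real n powr (- a)"
        using x by (cases "n = 0") (auto intro!: powr_mono)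
      then have "norm (f n) * (ln (real n) * real n powr (- x)) \<le> 1 * (ln (real n) * real n powr (- a))"
        using f ln0 by (intro mult_mono) auto
      then show "norm (- (f n * ln (real n) * of_real (real n powr (- x)))) \<le> ln (real n) ^ 1 * real n powr (- a)"
        using ln0[of n] by (simp add: norm_mult mult_ac)
    qed
    have eq: "(\<Sum>i. - (f i * ln (real i) * of_real (real i powr (- x)))) = - dser (\<lambda>n. f n * ln (real n)) x"
      if "x \<in> {a<..}" for x
      using sums_minus[OF dser_sums[OF lb(2), of x]] that a by (auto simp: sums_iff)
    show "uniform_limit {a<..} (\<lambda>n x. \<Sum>i<n. - (f i * ln (real i) * of_real (real i powr (- x))))
       (\<lambda>x. - dser (\<lambda>n. f n * ln (real n)) x) sequentially"
      by (rule uniform_limit_cong'[THEN iffD1, OF _ eq lim]) simp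
    show "s \<in> {a<..}" using a by simp
    show "(\<lambda>n. f n * of_real (real n powr (- s))) sums dser f s" using dser_sums[OF lb(1) s] .
  qed auto
  then obtain g where g: "\<And>x. a < x \<Longrightarrow> (\<lambda>n. f n * of_real (real n powr (- x))) sums g x"
     "\<And>x. a < x \<Longrightarrow> (g has_vector_derivative - dser (\<lambda>n. f n * ln (real n)) x) (at x within {a<..})"
    by blast
  have "g x = dser f x" if "a < x" for x
    using g(1)[OF that] by (simp add: dser_def sums_iff)
  then have "(dser f has_vector_derivative - dser (\<lambda>n. f n * ln (real n)) s) (at s within {a<..})"
    using has_vector_derivative_transform[of s "{a<..}" "dser f" g] g(2)[OF a(2)] a by auto
  moreover have "at s within {a<..} = at s" by (rule at_within_open) (use a in auto)
  ultimately show ?thesis by simp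
qed

section \<open>Nonprincipal characters\<close>

text \<open>Multiplication by a unit \<open>a\<close> with \<open>\<psi> a \<noteq> 1\<close>
  permutes the residues, so the sum equals \<open>\<psi> a\<close> times itself.\<close>

lemma sum_dchars_period:
  assumes N: "N > 0" and \<psi>: "\<psi> \<in> dchars N" "\<psi> \<noteq> principal_char N"
  shows "(\<Sum>n<N. \<psi> n) = 0"
proof -
  obtain a where "\<psi> a \<noteq> principal_char N a" using \<psi>(2) by blast
  then have a: "coprime a N" "\<psi> a \<noteq> 1"
    using dcharsD(4)[OF \<psi>(1), of a] by (auto simp: principal_char_def split: if_splits)
  have inj: "inj_on (\<lambda>n. a * n mod N) {..<N}"
  proof (rule inj_onI)
    fix x y assume xy: "x \<in> {..<N}" "y \<in> {..<N}" "a * x mod N = a * y mod N"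
    then have "[a * x = a * y] (mod N)" by (simp add: Cong.cong_def)
    then have "[x = y] (mod N)"
      using a(1) by (simp add: cong_mult_lcancel_nat)
    then show "x = y" using xy by (simp add: Cong.cong_def)
  qed
  have "(\<lambda>n. a * n mod N) ` {..<N} = {..<N}"
    by (rule endo_inj_surj) (use inj N in auto)
  then have "(\<Sum>n<N. \<psi> n) = (\<Sum>n<N. \<psi> (a * n mod N))"
    using sum.reindex[OF inj, of \<psi>] by simp
  also have "\<dots> = (\<Sum>n<N. \<psi> a * \<psi> n)"
  proof (intro sum.cong refl)
    fix n show "\<psi> (a * n mod N) = \<psi> a * \<psi> n"
      using dcharsD(3)[OF \<psi>(1), of "a * n mod N" "a * n"] dcharsD(2)[OF \<psi>(1), of a n] by (simp add: Cong.cong_def)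
  qed
  also have "\<dots> = \<psi> a * (\<Sum>n<N. \<psi> n)" by (simp add: sum_distrib_left)
  finally show ?thesis using a(2) by simp
qed

text \<open>Full periods cancel, which leaves fewer than \<open>N\<close> terms of modulus at most
  1.\<close>

lemma norm_sum_dchars_le:
  assumes N: "N > 0" and \<psi>: "\<psi> \<in> dchars N" "\<psi> \<noteq> principal_char N"
  shows "norm (\<Sum>n<m. \<psi> n) \<le> real N"
proof (induction m rule: less_induct)
  case (less m)
  show ?case
  proof (cases "m < N")
    case True
    have "norm (\<Sum>n<m. \<psi> n) \<le> (\<Sum>n<m. 1)"
      by (rule sum_norm_le) (rule norm_dchars_le[OF N \<psi>(1)])
    then show ?thesis using True by simp
  next
    case False
    have shift: "(\<Sum>n<k + N. \<psi> n) = (\<Sum>n<k. \<psi> n)" for k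
    proof (induction k)
      case 0
      then show ?case using sum_dchars_period[OF assms] by simp
    next
      case (Suc k)
      have "\<psi> (k + N) = \<psi> k" by (rule dcharsD(3)[OF \<psi>(1)]) (simp add: Cong.cong_def)
      then show ?case using Suc by simp
    qed
    show ?thesis using less.IH[of "m - N"] shift[of "m - N"] False N by simp
  qed
qed

text \<open>Abel summation: the boundary terms cost \<open>B * g M\<close> and
  \<open>B * g K\<close>, and the remaining sum telescopes to \<open>B * (g K - g M)\<close>. The
  bound depends only on the first weight, hence can be uniform in a parameter of
  \<open>g\<close>.\<close>

lemma norm_sum_antimono_le:
  fixes a :: "nat \<Rightarrow> 'a :: real_normed_field" and g :: "nat \<Rightarrow> real"
  assumes a: "\<And>m. norm (\<Sum>n<m. a n) \<le> B"
    and g: "\<And>n. K \<le> n \<Longrightarrow> g (Suc n) \<le> g n" "\<And>n. K \<le> n \<Longrightarrow> 0 \<le> g n"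
  shows "norm (\<Sum>n=K..<M. a n * of_real (g n)) \<le> 2 * B * g K"
proof (cases "K \<le> M")
  case True
  define A where "A m = (\<Sum>n<m. a n)" for m
  have eq: "(\<Sum>n=K..<M. a n * of_real (g n)) = A M * of_real (g M) - A K * of_real (g K) +
      (\<Sum>n=K..<M. A (Suc n) * of_real (g n - g (Suc n)))"
    using True
  proof (induction M rule: dec_induct)
    case (step M)
    then show ?case by (simp add: A_def algebra_simps)
  qed simp
  have tele: "(\<Sum>n=K..<M. g n - g (Suc n)) = g K - g M"
    using True by (induction M rule: dec_induct) auto
  have 1: "norm (A m * of_real x) \<le> B * x" if "0 \<le> x" for m x
    using mult_right_mono[OF a that, of m] that by (simp add: norm_mult A_def)
  have "norm (\<Sum>n=K..<M. A (Suc n) * of_real (g n - g (Suc n))) \<le> (\<Sum>n=K..<M. B * (g n - g (Suc n)))"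
    by (intro sum_norm_le 1) (use g in auto)
  also have "\<dots> = B * (g K - g M)" by (simp only: sum_distrib_left[symmetric] tele)
  finally have "norm (\<Sum>n=K..<M. A (Suc n) * of_real (g n - g (Suc n))) \<le> B * (g K - g M)" .
  moreover have "norm (A M * of_real (g M)) \<le> B * g M" "norm (A K * of_real (g K)) \<le> B * g K"
    using 1 g(2) True by auto
  ultimately have "norm (\<Sum>n=K..<M. a n * of_real (g n)) \<le> B * g M + B * g K + B * (g K - g M)"
    unfolding eq by (intro norm_triangle_le norm_triangle_le_diff add_mono) auto
  then show ?thesis by (simp add: algebra_simps)
next
  case False
  have "0 \<le> B" using a[of 0] by simp
  then show ?thesis using False g(2) by simp
qed

text \<open>Dirichlet's test, by the Cauchy criterion: a block starting at \<open>m\<close> is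
  bounded by \<open>2 * B * g m\<close>, which tends to 0.\<close>

lemma summable_antimono:
  fixes a :: "nat \<Rightarrow> 'a :: {real_normed_field, banach}" and g :: "nat \<Rightarrow> real"
  assumes a: "\<And>m. norm (\<Sum>n<m. a n) \<le> B"
    and g: "\<And>n. K \<le> n \<Longrightarrow> g (Suc n) \<le> g n" "g \<longlonglongrightarrow> 0"
  shows "summable (\<lambda>n. a n * of_real (g n))"
  unfolding summable_Cauchy
proof (intro allI impI)
  fix e :: real assume e: "e > 0"
  have B: "0 \<le> B" using a[of 0] by simp
  have dec: "g n \<le> g m" if "K \<le> m" "m \<le> n" for m n
    using that(2)
  proof (induction n rule: dec_induct)
    case (step n)
    then show ?case using g(1)[of n] that(1) by linarith
  qed simp
  have nonneg: "0 \<le> g n" if "K \<le> n" for n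
    by (rule LIMSEQ_le_const2[OF g(2)]) (use dec[OF that] in blast)
  have "\<forall>\<^sub>F n in sequentially. 2 * B * g n < e"
    by (rule order_tendstoD(2)[OF tendsto_mult_right_zero[OF g(2)]]) (use e in auto)
  then obtain M where M: "\<And>n. n \<ge> M \<Longrightarrow> 2 * B * g n < e" by (auto simp: eventually_sequentially)
  have "norm (\<Sum>k=m..<n. a k * of_real (g k)) < e" if "m \<ge> max K M" for m n
  proof -
    have "norm (\<Sum>k=m..<n. a k * of_real (g k)) \<le> 2 * B * g m"
      by (intro norm_sum_antimono_le a g(1) nonneg) (use that in auto)
    then show ?thesis using M[of m] that by simp
  qed
  then show "\<exists>M. \<forall>m\<ge>M. \<forall>n. norm (\<Sum>k=m..<n. a k * of_real (g k)) < e" by blast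
qed

lemma powr_minus_antimono_nat:
  assumes "0 \<le> s" "0 < n"
  shows "real (Suc n) powr (- s) \<le> real n powr (- s)"
  using assms by (intro powr_mono2') auto

lemma tendsto_nat_powr_minus: "s > 0 \<Longrightarrow> (\<lambda>n. real n powr (- s)) \<longlonglongrightarrow> 0"
  by real_asymp

section \<open>Nonprincipal series on the ray from 1\<close>

context
  fixes N :: nat and \<psi> :: "nat \<Rightarrow> complex"
  assumes N: "N > 0" and \<psi>: "\<psi> \<in> dchars N" "\<psi> \<noteq> principal_char N"
begin

text \<open>Dirichlet's test is started at index 1, since \<open>0 powr (- s) = 0\<close> breaks the
  monotonicity of the weights at 0.\<close>

lemma dser_nonprincipal_sums:
  assumes "s > 0"
  shows "(\<lambda>n. \<psi> n * of_real (real n powr (- s))) sums dser \<psi> s"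
  unfolding dser_def
  by (intro summable_sums summable_antimono[where B = N and K = 1] norm_sum_dchars_le[OF N \<psi>]
       powr_minus_antimono_nat tendsto_nat_powr_minus) (use assms in auto)

text \<open>For \<open>s \<ge> 1\<close> the tail from \<open>m\<close> on is at most
  \<open>2 * N / m\<close> by Abel summation, uniformly in \<open>s\<close>. The endpoint 1 is
  included for the later use of the mean value inequality.\<close>

lemma continuous_on_dser_nonprincipal: "continuous_on {1..} (dser \<psi>)"
proof (rule uniform_limit_theorem)
  show "\<forall>\<^sub>F m in sequentially. continuous_on {1..} (\<lambda>s. \<Sum>n<m. \<psi> n * of_real (real n powr (- s)))"
  proof (intro always_eventually allI continuous_on_sum continuous_on_mult continuous_on_const continuous_on_of_real)
    show "continuous_on {1..} (\<lambda>s. real n powr (- s))" for n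
      by (cases "n = 0") (auto intro!: continuous_intros)
  qed
  have tail: "dist (\<Sum>n<m. \<psi> n * of_real (real n powr (- s))) (dser \<psi> s) \<le> 2 * real N * real m powr (- 1)"
    if s: "s \<in> {1..}" and m: "m > 0" for s m
  proof -
    let ?f = "\<lambda>n. \<psi> n * of_real (real n powr (- s))"
    have "norm ((\<Sum>n<k. ?f n) - (\<Sum>n<m. ?f n)) \<le> 2 * real N * real m powr (- 1)" if "k \<ge> m" for k
    proof -
      have "(\<Sum>n<k. ?f n) - (\<Sum>n<m. ?f n) = (\<Sum>n=m..<k. ?f n)"
        using that sum_diff_nat_ivl[of 0 m k ?f] by (simp add: atLeast0LessThan)
      also have "norm \<dots> \<le> 2 * real N * real m powr (- s)"
        by (intro norm_sum_antimono_le norm_sum_dchars_le[OF N \<psi>] powr_minus_antimono_nat)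
          (use s m in auto)
      also have "\<dots> \<le> 2 * real N * real m powr (- 1)"
        using s m by (intro mult_left_mono powr_mono) auto
      finally show ?thesis .
    qed
    moreover have "(\<lambda>k. norm ((\<Sum>n<k. ?f n) - (\<Sum>n<m. ?f n))) \<longlonglongrightarrow> norm (dser \<psi> s - (\<Sum>n<m. ?f n))"
      using dser_nonprincipal_sums[of s] s unfolding sums_def by (intro tendsto_intros) auto
    ultimately have "norm (dser \<psi> s - (\<Sum>n<m. ?f n)) \<le> 2 * real N * real m powr (- 1)"
      by (intro LIMSEQ_le_const2) auto
    then show ?thesis by (simp add: dist_norm norm_minus_commute)
  qed
  show "uniform_limit {1..} (\<lambda>m s. \<Sum>n<m. \<psi> n * of_real (real n powr (- s))) (dser \<psi>) sequentially"
  proof (rule uniform_limitI)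
    fix e :: real assume "e > 0"
    have "(\<lambda>m. 2 * real N * real m powr (- 1)) \<longlonglongrightarrow> 0"
      by (rule tendsto_mult_right_zero[OF tendsto_nat_powr_minus]) simp
    then have "\<forall>\<^sub>F m in sequentially. 2 * real N * real m powr (- 1) < e"
      using \<open>e > 0\<close> by (rule order_tendstoD)
    then show "\<forall>\<^sub>F m in sequentially. \<forall>s\<in>{1..}. dist (\<Sum>n<m. \<psi> n * of_real (real n powr (- s))) (dser \<psi> s) < e"
      using eventually_gt_at_top[of 0]
    proof eventually_elim
      case (elim m)
      then show ?case using tail[OF _ elim(2)] by (intro ballI) (rule le_less_trans)
    qed
  qed
qed auto

text \<open>Abel summation again, now uniformly in \<open>s\<close>: the weights
  \<open>ln n * n powr (- s)\<close> decrease from 3 on, and the first of these is at most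
  \<open>ln 3\<close>.\<close>

lemma dser_nonprincipal_deriv_bounded:
  obtains C where "\<And>s. s > 1 \<Longrightarrow> norm (dser (\<lambda>n. \<psi> n * ln (real n)) s) \<le> C"
proof
  fix s :: real assume s: "s > 1"
  define g where "g n = ln (real n) * real n powr (- s)" for n
  have ln0: "ln (real n) \<ge> 0" for n by (cases "n = 0") auto
  have le1: "real n powr (- s) \<le> 1" for n
    using s powr_mono[of "- s" 0 "real n"] by (cases "n = 0") auto
  \<comment> \<open>The weight is \<open>ln n / n\<close> times a decreasing power. The first factor
    decreases beyond \<open>exp 1\<close>, which is why the tail starts at 3.\<close>
  have dec: "g (Suc n) \<le> g n" if "n \<ge> 3" for n
  proof -
    have eq: "g m = ln (real m) / real m * real m powr (- (s - 1))" if "m > 0" for m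
      using that by (simp add: g_def powr_diff powr_minus field_simps)
    have e3: "exp 1 \<le> real n" using exp_le that by (meson numeral_le_real_of_nat_iff order_trans)
    have "ln (real (Suc n)) / real (Suc n) * real (Suc n) powr (- (s - 1)) \<le> ln (real n) / real n * real n powr (- (s - 1))"
      using that s e3
      by (intro mult_mono powr_minus_antimono_nat ln_x_over_x_mono) auto
    then show ?thesis using eq that by simp
  qed
  have tail: "norm (\<Sum>n=3..<k. \<psi> n * of_real (g n)) \<le> 2 * real N * ln 3" for k
  proof -
    have "norm (\<Sum>n=3..<k. \<psi> n * of_real (g n)) \<le> 2 * real N * g 3"
      by (intro norm_sum_antimono_le norm_sum_dchars_le[OF N \<psi>] dec) (auto simp: g_def ln0)
    also have "g 3 \<le> ln 3 * 1" unfolding g_def using le1[of 3] by (intro mult_mono) auto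
    finally show ?thesis by (simp add: mult_left_mono)
  qed
  \<comment> \<open>The terms at 0 and 1 vanish, so only \<open>n = 2\<close> is left.\<close>
  have head: "norm (\<Sum>n=0..<3. \<psi> n * of_real (g n)) \<le> ln 2"
  proof -
    have "(\<Sum>n=0..<3. \<psi> n * of_real (g n)) = \<psi> 2 * of_real (g 2)"
      by (simp add: numeral_3_eq_3 numeral_2_eq_2 g_def)
    also have "norm \<dots> \<le> 1 * g 2"
      using mult_right_mono[OF norm_dchars_le[OF N \<psi>(1), of 2], of "g 2"] ln0[of 2]
      by (simp add: norm_mult g_def)
    also have "g 2 \<le> ln 2 * 1" unfolding g_def using le1[of 2] by (intro mult_mono) auto
    finally show ?thesis by simp
  qed
  have "(\<lambda>n. \<psi> n * ln (real n) * of_real (real n powr (- s))) sums dser (\<lambda>n. \<psi> n * ln (real n)) s"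
    by (intro dser_sums log_bounded_dchars(3)[OF N \<psi>(1)] s)
  then have "(\<lambda>n. \<psi> n * of_real (g n)) sums dser (\<lambda>n. \<psi> n * ln (real n)) s"
    by (simp add: g_def mult.assoc)
  then have "(\<lambda>k. norm (\<Sum>n<k. \<psi> n * of_real (g n))) \<longlonglongrightarrow> norm (dser (\<lambda>n. \<psi> n * ln (real n)) s)"
    unfolding sums_def by (rule tendsto_norm)
  moreover have "norm (\<Sum>n<k. \<psi> n * of_real (g n)) \<le> ln 2 + 2 * real N * ln 3" if "k \<ge> 3" for k
  proof -
    have "(\<Sum>n<k. \<psi> n * of_real (g n)) = (\<Sum>n=0..<3. \<psi> n * of_real (g n)) + (\<Sum>n=3..<k. \<psi> n * of_real (g n))"
      using that by (simp add: sum.atLeastLessThan_concat lessThan_atLeast0)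
    then show ?thesis using head tail[of k] by (simp add: norm_triangle_le)
  qed
  ultimately show "norm (dser (\<lambda>n. \<psi> n * ln (real n)) s) \<le> ln 2 + 2 * real N * ln 3"
    by (intro LIMSEQ_le_const2) auto
qed

text \<open>Mean value inequality on the interval from 1 to \<open>s\<close>: continuity at 1 and a
  derivative bound in the interior suffice.\<close>

lemma dser_nonprincipal_Lipschitz:
  obtains C where "C > 0" "\<And>s. s > 1 \<Longrightarrow> norm (dser \<psi> s - dser \<psi> 1) \<le> C * (s - 1)"
proof -
  obtain C where C: "\<And>s. s > 1 \<Longrightarrow> norm (dser (\<lambda>n. \<psi> n * ln (real n)) s) \<le> C"
    using dser_nonprincipal_deriv_bounded by blast
  have "norm (dser \<psi> s - dser \<psi> 1) \<le> (\<bar>C\<bar> + 1) * (s - 1)" if s: "s > 1" for s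
  proof -
    have "norm (dser \<psi> s - dser \<psi> 1) \<le> C * s - C * 1"
    proof (rule differentiable_bound_general[OF s, where f' = "\<lambda>s. - dser (\<lambda>n. \<psi> n * ln (real n)) s" and \<phi>' = "\<lambda>_. C"])
      show "continuous_on {1..s} (dser \<psi>)"
        using continuous_on_dser_nonprincipal by (rule continuous_on_subset) auto
      show "(dser \<psi> has_vector_derivative - dser (\<lambda>n. \<psi> n * ln (real n)) x) (at x)" if "1 < x" for x
        by (intro dser_has_vector_derivative norm_dchars_le[OF N \<psi>(1)] that)
    qed (auto intro!: continuous_intros derivative_eq_intros C)
    also have "\<dots> = C * (s - 1)" by (simp add: algebra_simps)
    also have "\<dots> \<le> (\<bar>C\<bar> + 1) * (s - 1)" using s by (intro mult_right_mono) auto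
    finally show ?thesis .
  qed
  then show thesis using that[of "\<bar>C\<bar> + 1"] by auto
qed

end

section \<open>Nonvanishing at 1 for real characters\<close>

text \<open>What is used of a real character: complete multiplicativity and the three possible
  values. Periodicity enters only afterwards.\<close>

locale sign_char =
  fixes x :: "nat \<Rightarrow> real"
  assumes one: "x 1 = 1" and mult: "x (m * n) = x m * x n" and sign: "x n \<in> {-1, 0, 1}"
begin

definition r :: "nat \<Rightarrow> real" where "r n = (\<Sum>d | d dvd n. x d)"

lemma x_power: "x (m ^ k) = x m ^ k"
  by (induction k) (use one mult in simp_all)

text \<open>The divisors of \<open>p ^ k * m\<close> are the products \<open>p ^ i * e\<close> with
  \<open>i \<le> k\<close> and \<open>e\<close> dividing \<open>m\<close>, uniquely because
  \<open>p\<close> does not divide \<open>m\<close>.\<close>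

lemma r_prime_power_mult:
  assumes p: "prime p" "\<not> p dvd m" and m: "m > 0"
  shows "r (p ^ k * m) = (\<Sum>i\<le>k. x p ^ i) * r m"
proof -
  have copk: "coprime (p ^ i) e" if "e dvd m" for i e
    using p that by (meson coprime_power_left_iff dvd_trans prime_imp_coprime)
  have inj: "inj_on (\<lambda>(i, e). p ^ i * e) ({..k} \<times> {e. e dvd m})"
  proof (rule inj_onI, clarify)
    fix i e j f assume *: "e dvd m" "f dvd m" "p ^ i * e = p ^ j * f"
    have nd: "\<not> p dvd e" "\<not> p dvd f" "e \<noteq> 0" "f \<noteq> 0"
      using p m * dvd_trans by auto
    have "multiplicity p (p ^ i * e) = i" "multiplicity p (p ^ j * f) = j"
      using nd p by (auto intro!: multiplicity_eqI simp: prime_gt_0_nat)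
    then have "i = j" using * by simp
    then show "i = j \<and> e = f" using *(3) p(1) by (simp add: prime_gt_0_nat)
  qed
  have img: "(\<lambda>(i, e). p ^ i * e) ` ({..k} \<times> {e. e dvd m}) = {d. d dvd p ^ k * m}"
  proof (intro equalityI subsetI)
    fix d assume "d \<in> {d. d dvd p ^ k * m}"
    then obtain a e where "d = a * e" "a dvd p ^ k" "e dvd m"
      using division_decomp[of d "p ^ k" m] by auto
    moreover then obtain i where "i \<le> k" "a = p ^ i"
      using divides_primepow_nat[OF p(1)] by auto
    ultimately show "d \<in> (\<lambda>(i, e). p ^ i * e) ` ({..k} \<times> {e. e dvd m})" by auto
  next
    fix d assume "d \<in> (\<lambda>(i, e). p ^ i * e) ` ({..k} \<times> {e. e dvd m})"
    then show "d \<in> {d. d dvd p ^ k * m}"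
      by (auto intro!: mult_dvd_mono le_imp_power_dvd)
  qed
  have "r (p ^ k * m) = (\<Sum>(i, e)\<in>{..k} \<times> {e. e dvd m}. x (p ^ i * e))"
    unfolding r_def img[symmetric] by (subst sum.reindex[OF inj]) (simp add: case_prod_unfold)
  also have "\<dots> = (\<Sum>(i, e)\<in>{..k} \<times> {e. e dvd m}. x p ^ i * x e)"
    by (simp only: mult x_power)
  also have "\<dots> = (\<Sum>i\<le>k. x p ^ i) * r m"
    by (simp only: r_def sum_product sum.cartesian_product)
  finally show ?thesis .
qed

text \<open>Only \<open>x n = -1\<close> is delicate: the partial sums then alternate between 1 and
  0. Even exponents, as they occur in squares, give at least 1.\<close>

lemma sum_powers_ge: "(\<Sum>i\<le>k. x n ^ i) \<ge> (if even k then 1 else 0)"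
proof -
  consider "x n = -1" | "x n = 0" | "x n = 1" using sign[of n] by blast
  then show ?thesis
  proof cases
    case 1
    have "(\<Sum>i\<le>k. (- 1) ^ i :: real) = (if even k then 1 else 0)" by (induction k) auto
    then show ?thesis using 1 by simp
  next
    case 2
    have "(\<Sum>i\<le>k. 0 ^ i :: real) = 1" by (induction k) auto
    then show ?thesis using 2 by simp
  qed auto
qed

lemma r_1: "r 1 = 1"
  using one by (simp add: r_def)

lemma prime_power_split:
  fixes n :: nat
  assumes "n > 1"
  obtains p k m where "prime p" "\<not> p dvd m" "m > 0" "k > 0" "n = p ^ k * m" "m < n"
proof -
  obtain p where p: "prime p" "p dvd n" using prime_factor_nat[of n] assms by auto
  obtain m where m: "n = p ^ multiplicity p n * m" "\<not> p dvd m"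
    by (rule multiplicity_decompose'[of n p]) (use assms p not_prime_unit[of p] in auto)
  have k: "multiplicity p n > 0"
    using p assms by (simp add: prime_multiplicity_gt_zero_iff)
  have "m > 0" using m assms by (metis mult_0_right not_gr_zero not_less_zero)
  moreover have "p ^ multiplicity p n > 1" using one_less_power[OF prime_gt_1_nat[OF p(1)] k] .
  ultimately have "1 * m < p ^ multiplicity p n * m" by (intro mult_strict_right_mono)
  then have "m < n" using m(1) by simp
  then show thesis using that p m k \<open>m > 0\<close> by blast
qed

lemma r_nonneg: "n > 0 \<Longrightarrow> r n \<ge> 0"
proof (induction n rule: less_induct)
  case (less n)
  show ?case
  proof (cases "n = 1")
    case False
    then obtain p k m where *: "prime p" "\<not> p dvd m" "m > 0" "n = p ^ k * m" "m < n"
      using prime_power_split[of n] less.prems by (metis One_nat_def Suc_lessI)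
    have "0 \<le> (\<Sum>i\<le>k. x p ^ i)" using sum_powers_ge[of k p] by (auto split: if_splits)
    then have "0 \<le> r (p ^ k * m)"
      unfolding r_prime_power_mult[OF *(1-3)] by (intro mult_nonneg_nonneg less.IH *)
    then show ?thesis using *(4) by simp
  qed (simp add: r_1[unfolded One_nat_def])
qed

lemma r_square: "n > 0 \<Longrightarrow> r (n ^ 2) \<ge> 1"
proof (induction n rule: less_induct)
  case (less n)
  show ?case
  proof (cases "n = 1")
    case False
    then obtain p k m where *: "prime p" "\<not> p dvd m" "m > 0" "n = p ^ k * m" "m < n"
      using prime_power_split[of n] less.prems by (metis One_nat_def Suc_lessI)
    have "n ^ 2 = p ^ (2 * k) * m ^ 2"
      using *(4) by (simp add: power_mult_distrib power_mult[symmetric] mult.commute)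
    moreover have "\<not> p dvd m ^ 2" using *(1,2) prime_dvd_power by blast
    ultimately have "r (n ^ 2) = (\<Sum>i\<le>2 * k. x p ^ i) * r (m ^ 2)"
      using r_prime_power_mult[OF *(1), of "m ^ 2" "2 * k"] *(3) by simp
    moreover have "1 * 1 \<le> (\<Sum>i\<le>2 * k. x p ^ i) * r (m ^ 2)"
      using sum_powers_ge[of "2 * k" p] less.IH[OF *(5,3)] by (intro mult_mono) auto
    ultimately show ?thesis by simp
  qed (simp add: r_1[unfolded One_nat_def])
qed

text \<open>Expanding each \<open>t ^ d / (1 - t ^ d)\<close> as a geometric series gives the
  absolutely convergent double series of \<open>x d * t ^ (d * e)\<close>. Summing over
  \<open>e\<close> first gives one form, grouping by \<open>n = d * e\<close> the other.\<close>

lemma lambert_series: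
  assumes t: "0 < t" "t < 1"
  obtains U where "((\<lambda>n. r n * t ^ n) has_sum U) {0<..}"
    "(\<lambda>n. x n * (t ^ n / (1 - t ^ n))) sums U"
proof -
  have tn: "t ^ n < 1" "0 < t ^ n" "t ^ n \<le> t" if "n > 0" for n
    using that t by (auto simp: power_less_one_iff power_le_one intro!: power_decreasing[of 1 n t, simplified])
  have geo: "((\<lambda>e. t ^ (d * e)) has_sum (t ^ d / (1 - t ^ d))) {0<..}" if "d > 0" for d
  proof -
    have "{0<..} = {1::nat..}" by auto
    then show ?thesis
      using has_sum_geometric_from_1[of "t ^ d"] tn[OF that] by (simp add: power_mult)
  qed
  \<comment> \<open>This majorizes the row sums because \<open>t ^ d \<le> t\<close>.\<close>
  have "(\<lambda>d. t ^ d / (1 - t)) summable_on {0<..}"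
  proof -
    have "(\<lambda>d. t ^ d) summable_on {0<..}"
      using geo[of 1] by (auto simp: summable_on_def)
    then show ?thesis
      using summable_on_cmult_left[of "\<lambda>d. t ^ d" "{0<..}" "1 / (1 - t)"] by simp
  qed
  then have "(\<lambda>d. t ^ d / (1 - t ^ d)) summable_on {0<..}"
    by (rule summable_on_comparison_test) (use tn t in \<open>auto intro!: divide_left_mono mult_pos_pos simp: less_imp_le\<close>)
  then have "(\<lambda>(d, e). t ^ (d * e)) summable_on {0<..} \<times> {0<..}"
    by (intro summable_on_SigmaI[where g = "\<lambda>d. t ^ d / (1 - t ^ d)"]) (use geo t in auto)
  then have "(\<lambda>p. norm (case p of (d, e) \<Rightarrow> x d * t ^ (d * e))) summable_on {0<..} \<times> {0<..}"
  proof (rule Infinite_Sum.abs_summable_on_comparison_test')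
    fix p :: "nat \<times> nat"
    obtain d e where p: "p = (d, e)" by fastforce
    have "\<bar>x d\<bar> \<le> 1" using sign[of d] by auto
    then have "\<bar>x d\<bar> * t ^ (d * e) \<le> 1 * t ^ (d * e)" using t by (intro mult_right_mono) auto
    then show "norm (case p of (d, e) \<Rightarrow> x d * t ^ (d * e)) \<le> (case p of (d, e) \<Rightarrow> t ^ (d * e))"
      using t p by (simp add: abs_mult)
  qed
  then have "(\<lambda>(d, e). x d * t ^ (d * e)) summable_on {0<..} \<times> {0<..}"
    by (rule Infinite_Sum.abs_summable_summable)
  then obtain U where U: "((\<lambda>(d, e). x d * t ^ (d * e)) has_sum U) ({0<..} \<times> {0<..})"
    by (auto simp: summable_on_def)
  have "((\<lambda>n. \<Sum>d | d dvd n. x d * t ^ n) has_sum U) {0<..}"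
    using has_sum_divisor_pairs[OF U]
    by (rule has_sum_cong[THEN iffD1, rotated]) (auto intro!: sum.cong)
  then have "((\<lambda>n. r n * t ^ n) has_sum U) {0<..}"
    by (simp add: r_def sum_distrib_right)
  moreover have "((\<lambda>d. x d * (t ^ d / (1 - t ^ d))) has_sum U) {0<..}"
    by (rule has_sum_SigmaD[OF U]) (use has_sum_cmult_right[OF geo] in auto)
  then have "((\<lambda>d. x d * (t ^ d / (1 - t ^ d))) has_sum U) UNIV"
    by (rule has_sum_cong_neutral[THEN iffD1, rotated -1]) auto
  then have "(\<lambda>n. x n * (t ^ n / (1 - t ^ n))) sums U" by (rule has_sum_imp_sums)
  ultimately show thesis by (rule that)
qed

end

text \<open>Pair the exponent \<open>i\<close> with \<open>n - 1 - i\<close>: the two terms are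
  squares with product \<open>u ^ (2 * (n - 1))\<close>, so twice their geometric mean bounds their
  sum from below.\<close>

lemma geometric_sum_ge:
  fixes u :: real
  shows "real n * u ^ (n - 1) \<le> (\<Sum>i<n. (u ^ 2) ^ i)"
proof -
  have "2 * (real n * u ^ (n - 1)) = (\<Sum>i<n. 2 * u ^ (n - 1))" by simp
  also have "\<dots> \<le> (\<Sum>i<n. (u ^ 2) ^ i + (u ^ 2) ^ (n - Suc i))"
  proof (rule sum_mono)
    fix i assume "i \<in> {..<n}"
    then have "u ^ (n - 1) = u ^ i * u ^ (n - Suc i)" by (simp flip: power_add)
    moreover have "2 * (u ^ i * u ^ (n - Suc i)) \<le> (u ^ i) ^ 2 + (u ^ (n - Suc i)) ^ 2"
      using sum_squares_bound[of "u ^ i" "u ^ (n - Suc i)"] by (simp add: mult.assoc)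
    ultimately show "2 * u ^ (n - 1) \<le> (u ^ 2) ^ i + (u ^ 2) ^ (n - Suc i)"
      by (simp add: power_mult[symmetric] mult.commute)
  qed
  also have "\<dots> = 2 * (\<Sum>i<n. (u ^ 2) ^ i)"
    by (simp add: sum.distrib sum.nat_diff_reindex[of "\<lambda>i. (u ^ 2) ^ i"])
  finally show ?thesis by simp
qed

text \<open>Monsky's weights: if \<open>\<Sum> x n / n = 0\<close>, then \<open>- \<Sum> x n * (t ^ n / (1 - t ^ n))\<close> equals
  \<open>\<Sum> x n * monsky t n\<close>, and since these weights decrease from 1, it is bounded
  uniformly in \<open>t\<close>.\<close>

definition monsky :: "real \<Rightarrow> nat \<Rightarrow> real" where
  "monsky t n = 1 / (real n * (1 - t)) - t ^ n / (1 - t ^ n)"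

context
  fixes t :: real
  assumes t: "0 < t" "t < 1"
begin

lemma one_minus_power: "1 - t ^ n = (1 - t) * (\<Sum>i<n. t ^ i)"
  by (metis power_one sum_gp_strict one_diff_power_eq)

text \<open>Apply the preceding estimate with \<open>u = sqrt t\<close> to both sums. The exponents
  \<open>n - 1\<close> and \<open>n\<close> add up to \<open>2 * n - 1\<close>, and
  \<open>u ^ (2 * n - 1) \<ge> t ^ n\<close>.\<close>

lemma geometric_sum_mult_ge:
  assumes "n > 0"
  shows "real n * real (Suc n) * t ^ n \<le> (\<Sum>i<n. t ^ i) * (\<Sum>i<Suc n. t ^ i)"
proof -
  define u where "u = sqrt t"
  have u: "0 < u" "u < 1" "u ^ 2 = t" using t by (auto simp: u_def)
  have "real n * real (Suc n) * t ^ n = real n * real (Suc n) * u ^ (2 * n)"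
    by (simp add: power_mult u)
  also have "\<dots> \<le> real n * real (Suc n) * u ^ (2 * n - 1)"
    using u by (intro mult_left_mono power_decreasing) auto
  also have "u ^ (2 * n - 1) = u ^ (n - 1) * u ^ (Suc n - 1)"
    using assms by (simp flip: power_add add: mult_2)
  also have "real n * real (Suc n) * (u ^ (n - 1) * u ^ (Suc n - 1)) =
      (real n * u ^ (n - 1)) * (real (Suc n) * u ^ (Suc n - 1))" by simp
  also have "\<dots> \<le> (\<Sum>i<n. (u ^ 2) ^ i) * (\<Sum>i<Suc n. (u ^ 2) ^ i)"
    by (intro mult_mono geometric_sum_ge sum_nonneg mult_nonneg_nonneg zero_le_power) (use u in auto)
  finally show ?thesis by (simp add: u)
qed

lemma geometric_sum_pos: "n > 0 \<Longrightarrow> (\<Sum>i<n. t ^ i) > 0"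
  using t by (intro sum_pos) auto

text \<open>After the factor \<open>1 / (1 - t)\<close> is split off, the first parts of two
  successive weights differ by \<open>1 / (n * (n + 1))\<close> and the second parts by
  \<open>t ^ n / (A * B)\<close>; the latter is no larger. The identity \<open>B = 1 + t * A\<close>
  collapses the second difference.\<close>

lemma monsky_decreasing:
  assumes n: "n > 0"
  shows "monsky t (Suc n) \<le> monsky t n"
proof -
  define A B where "A = (\<Sum>i<n. t ^ i)" and "B = (\<Sum>i<Suc n. t ^ i)"
  have AB: "A > 0" "B > 0" "B = A + t ^ n"
    unfolding A_def B_def using geometric_sum_pos[OF n] geometric_sum_pos[of "Suc n"] by simp_all
  have B': "B = 1 + t * A"
    using one_minus_power[of n] one_minus_power[of "Suc n"] t
    by (simp add: A_def[symmetric] AB(3) algebra_simps)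
  have "t ^ n / A - t ^ Suc n / B = t ^ n * (B - t * A) / (A * B)"
    using AB(1,2) by (simp add: field_simps)
  also have "\<dots> = t ^ n / (A * B)" by (simp add: B')
  also have "\<dots> \<le> 1 / (real n * real (Suc n))"
    using geometric_sum_mult_ge[OF n] AB n unfolding A_def[symmetric] B_def[symmetric]
    by (simp add: divide_simps mult_ac)
  also have "\<dots> = 1 / real n - 1 / real (Suc n)" using n by (simp add: field_simps)
  finally have "(1 / real (Suc n) - t ^ Suc n / B) / (1 - t) \<le> (1 / real n - t ^ n / A) / (1 - t)"
    using t by (intro divide_right_mono) auto
  then show ?thesis
    unfolding monsky_def one_minus_power[of n] one_minus_power[of "Suc n"] A_def[symmetric] B_def[symmetric]
    by (simp add: diff_divide_distrib mult.commute)
qed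

lemma monsky_nonneg:
  assumes n: "n > 0"
  shows "0 \<le> monsky t n"
proof -
  have "real n * t ^ n = (\<Sum>i<n. t ^ n)" by simp
  also have "\<dots> \<le> (\<Sum>i<n. t ^ i)" using t by (intro sum_mono power_decreasing) auto
  finally have "t ^ n / (\<Sum>i<n. t ^ i) \<le> 1 / real n"
    using geometric_sum_pos[OF n] n by (simp add: field_simps)
  then have "t ^ n / (\<Sum>i<n. t ^ i) / (1 - t) \<le> 1 / real n / (1 - t)"
    using t by (intro divide_right_mono) auto
  then show ?thesis by (simp add: monsky_def one_minus_power mult.commute)
qed

lemma monsky_1: "monsky t 1 = 1"
  using t by (simp add: monsky_def field_simps)

end

text \<open>A zero at 1 would bound the Lambert series by \<open>2 * N\<close> for all
  \<open>t < 1\<close>. Its coefficients are nonnegative and at least 1 at squares, so letting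
  \<open>t\<close> tend to 1 in enough square terms exceeds this bound.\<close>

lemma dser_real_char_nonzero:
  assumes N: "N > 0" and \<psi>: "\<psi> \<in> dchars N" "\<psi> \<noteq> principal_char N"
    and real: "\<And>n. cnj (\<psi> n) = \<psi> n"
  shows "dser \<psi> 1 \<noteq> 0"
proof
  assume zero: "dser \<psi> 1 = 0"
  define x where "x n = Re (\<psi> n)" for n
  have \<psi>x: "\<psi> n = of_real (x n)" for n
    using real[of n] by (simp add: x_def complex_eq_iff)
  interpret sign_char x
  proof
    show "x 1 = 1" using dcharsD(1)[OF \<psi>(1)] by (simp add: x_def)
    show "x (m * n) = x m * x n" for m n
      using dcharsD(2)[OF \<psi>(1), of m n] by (simp add: \<psi>x flip: of_real_mult)
    show "x n \<in> {-1, 0, 1}" for n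
      using norm_dchars[OF N \<psi>(1), of n] by (auto simp: \<psi>x split: if_splits)
  qed
  have bound: "norm (\<Sum>n<m. x n) \<le> real N" for m
    using norm_sum_dchars_le[OF N \<psi>, of m] by (simp add: \<psi>x flip: of_real_sum)
  have "(\<lambda>n. \<psi> n * of_real (real n powr (- 1))) sums 0"
    using dser_nonprincipal_sums[OF N \<psi>, of 1] zero by simp
  then have "(\<lambda>n. Re (\<psi> n * of_real (real n powr (- 1)))) sums Re 0" by (rule sums_Re)
  then have sum0: "(\<lambda>n. x n * (1 / real n)) sums 0"
  proof -
    have "real n powr (- 1) = 1 / real n" for n by (simp add: powr_minus_divide)
    then show ?thesis using \<open>(\<lambda>n. Re (\<psi> n * of_real (real n powr (- 1)))) sums Re 0\<close>
      by (simp only: \<psi>x Re_complex_of_real zero_complex.sel flip: of_real_mult)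
  qed
  have le: "(\<Sum>n\<in>F. r n * t ^ n) \<le> 2 * real N" if t: "0 < t" "t < 1" and F: "finite F" "F \<subseteq> {0<..}" for t F
  proof -
    obtain U where U: "((\<lambda>n. r n * t ^ n) has_sum U) {0<..}" "(\<lambda>n. x n * (t ^ n / (1 - t ^ n))) sums U"
      using lambert_series[OF t] .
    have "(\<Sum>n\<in>F. r n * t ^ n) \<le> U"
      using U(1) F by (rule finite_sum_le_has_sum) (use r_nonneg t in auto)
    \<comment> \<open>The series with sum 0, scaled by \<open>1 / (1 - t)\<close>, minus the Lambert
      series has the terms \<open>x n * monsky t n\<close>.\<close>
    also have "(\<lambda>n. 1 / (1 - t) * (x n * (1 / real n)) - x n * (t ^ n / (1 - t ^ n))) sums (1 / (1 - t) * 0 - U)"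
      by (intro sums_diff sums_mult sum0 U(2))
    then have "(\<lambda>n. x n * monsky t n) sums (- U)"
      by (simp add: monsky_def algebra_simps)
    then have lim: "(\<lambda>m. norm (\<Sum>n<m. x n * monsky t n)) \<longlonglongrightarrow> norm (- U)"
      unfolding sums_def by (rule tendsto_norm)
    have "norm (\<Sum>n<m. x n * monsky t n) \<le> 2 * real N" if "m \<ge> 1" for m
    proof -
      \<comment> \<open>Division by zero makes \<open>monsky t 0 = 0\<close>, so the sum can start
        at 1, where the weights begin to decrease.\<close>
      have "(\<Sum>n<m. x n * monsky t n) = (\<Sum>n=1..<m. x n * monsky t n)"
        using that by (intro sum.mono_neutral_right) (auto simp: monsky_def not_less_eq_eq)
      also have "norm \<dots> \<le> 2 * real N * monsky t 1"
        using norm_sum_antimono_le[of x "real N" 1 "monsky t" m] bound monsky_decreasing[OF t] monsky_nonneg[OF t]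
        by simp
      finally show ?thesis using monsky_1[OF t] by simp
    qed
    then have "norm (- U) \<le> 2 * real N" by (intro LIMSEQ_le_const2[OF lim]) auto
    then have "U \<le> 2 * real N" by simp
    finally show ?thesis .
  qed
  \<comment> \<open>One more square than the bound \<open>2 * N\<close> permits.\<close>
  define F where "F = (\<lambda>n. n ^ 2) ` {1..2 * N + 1}"
  have F: "finite F" "F \<subseteq> {0<..}" by (auto simp: F_def)
  have "((\<lambda>t. \<Sum>n\<in>F. r n * t ^ n) \<longlongrightarrow> (\<Sum>n\<in>F. r n * 1 ^ n)) (at_left 1)"
    by (intro tendsto_intros)
  moreover have "\<forall>\<^sub>F t in at_left (1::real). t \<in> {0<..<1}"
    by (rule eventually_at_left_real) simp
  then have "\<forall>\<^sub>F t in at_left 1. (\<Sum>n\<in>F. r n * t ^ n) \<le> 2 * real N"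
    by eventually_elim (use le F in auto)
  ultimately have "(\<Sum>n\<in>F. r n * 1 ^ n) \<le> 2 * real N"
    by (rule tendsto_upperbound) simp
  moreover have "(\<Sum>n\<in>F. r n * 1 ^ n) = (\<Sum>n=1..2*N+1. r (n ^ 2))"
    unfolding F_def by (subst sum.reindex) (auto intro!: inj_onI)
  moreover have "(\<Sum>n=1..2*N+1. r (n ^ 2)) \<ge> (\<Sum>n=1..2*N+1. 1)"
    by (intro sum_mono r_square) auto
  ultimately show False by simp
qed

section \<open>Nonvanishing at 1 for all nonprincipal characters\<close>

text \<open>The condition selects the residue class inverse to \<open>b\<close>.\<close>

definition mangoldt_cong :: "nat \<Rightarrow> nat \<Rightarrow> real \<Rightarrow> real" where
  "mangoldt_cong N b s = (\<Sum>n. if [b * n = 1] (mod N) then mangoldt n * real n powr (- s) else 0)"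

lemma summable_mangoldt_cong:
  assumes "s > 1"
  shows "summable (\<lambda>n. if [b * n = 1] (mod N) then mangoldt n * real n powr (- s) else 0)"
proof (rule summable_comparison_test)
  show "summable (\<lambda>n. ln (real n) ^ 1 * real n powr (- s))"
    by (rule summable_ln_power_powr[OF assms])
  have "ln (real n) \<ge> 0" for n by (cases "n = 0") auto
  then show "\<exists>M. \<forall>n\<ge>M. norm (if [b * n = 1] (mod N) then mangoldt n * real n powr (- s) else 0)
      \<le> ln (real n) ^ 1 * real n powr (- s)"
    by (auto simp: abs_mult intro!: mult_right_mono mangoldt_le_ln)
qed

lemma mangoldt_cong_nonneg: "s > 1 \<Longrightarrow> mangoldt_cong N b s \<ge> 0"
  unfolding mangoldt_cong_def
  by (intro suminf_nonneg summable_mangoldt_cong) (auto intro!: mult_nonneg_nonneg mangoldt_nonneg)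

text \<open>Orthogonality applied termwise at \<open>b * n\<close>.\<close>

lemma sum_dchars_dser_mangoldt:
  assumes N: "N > 0" and s: "s > 1"
  shows "(\<Sum>\<psi>\<in>dchars N. \<psi> b * dser (\<lambda>n. \<psi> n * mangoldt n) s) =
    of_real (real (card (dchars N)) * mangoldt_cong N b s)"
proof -
  have "(\<lambda>n. \<Sum>\<psi>\<in>dchars N. \<psi> b * (\<psi> n * mangoldt n * of_real (real n powr (- s)))) sums
     (\<Sum>\<psi>\<in>dchars N. \<psi> b * dser (\<lambda>n. \<psi> n * mangoldt n) s)"
    by (intro sums_sum sums_mult dser_sums log_bounded_dchars(2)[OF N] s)
  moreover have "(\<Sum>\<psi>\<in>dchars N. \<psi> b * (\<psi> n * mangoldt n * of_real (real n powr (- s)))) =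
     of_real (real (card (dchars N)) * (if [b * n = 1] (mod N) then mangoldt n * real n powr (- s) else 0))" for n
  proof -
    have "(\<Sum>\<psi>\<in>dchars N. \<psi> b * (\<psi> n * mangoldt n * of_real (real n powr (- s)))) =
        (\<Sum>\<psi>\<in>dchars N. \<psi> (b * n)) * (mangoldt n * of_real (real n powr (- s)))"
      unfolding sum_distrib_right by (intro sum.cong refl) (simp add: dcharsD(2))
    then show ?thesis by (simp add: dchars_orthogonality[OF N])
  qed
  ultimately have "(\<lambda>n. complex_of_real (real (card (dchars N)) * (if [b * n = 1] (mod N) then mangoldt n * real n powr (- s) else 0))) sums
     (\<Sum>\<psi>\<in>dchars N. \<psi> b * dser (\<lambda>n. \<psi> n * mangoldt n) s)"
    by (simp only:)
  moreover have "(\<lambda>n. complex_of_real (real (card (dchars N)) * (if [b * n = 1] (mod N) then mangoldt n * real n powr (- s) else 0))) sums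
     of_real (real (card (dchars N)) * mangoldt_cong N b s)"
    unfolding mangoldt_cong_def
    by (intro sums_of_real sums_mult summable_sums summable_mangoldt_cong s)
  ultimately show ?thesis by (rule sums_unique2)
qed

section \<open>The product of all L-series\<close>

definition dser_prod :: "nat \<Rightarrow> real \<Rightarrow> complex" where
  "dser_prod N s = (\<Prod>\<psi>\<in>dchars N. dser \<psi> s)"

text \<open>Writing each \<open>L'\<close> as \<open>- L * F\<close> in the product rule restores
  the missing factor in every summand. This gives the logarithmic derivative without a logarithm and
  without dividing by a factor that might vanish.\<close>

lemma dser_prod_has_vector_derivative:
  assumes N: "N > 0" and s: "s > 1"
  shows "(dser_prod N has_vector_derivative
    - (real (card (dchars N)) * mangoldt_cong N 1 s) *\<^sub>R dser_prod N s) (at s)"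
proof -
  note fin = finite_dchars[OF N]
  have "(dser_prod N has_derivative (\<lambda>h. \<Sum>\<psi>\<in>dchars N. h *\<^sub>R (- dser (\<lambda>n. \<psi> n * ln (real n)) s) *
      (\<Prod>\<phi>\<in>dchars N - {\<psi>}. dser \<phi> s))) (at s)"
    unfolding dser_prod_def
    using dser_has_vector_derivative[OF norm_dchars_le[OF N] s]
    by (intro has_derivative_prod) (auto simp: has_vector_derivative_def)
  moreover have "(\<Sum>\<psi>\<in>dchars N. h *\<^sub>R (- dser (\<lambda>n. \<psi> n * ln (real n)) s) *
      (\<Prod>\<phi>\<in>dchars N - {\<psi>}. dser \<phi> s)) =
      h *\<^sub>R (- (real (card (dchars N)) * mangoldt_cong N 1 s) *\<^sub>R dser_prod N s)" for h
  proof -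
    have "(\<Sum>\<psi>\<in>dchars N. h *\<^sub>R (- dser (\<lambda>n. \<psi> n * ln (real n)) s) * (\<Prod>\<phi>\<in>dchars N - {\<psi>}. dser \<phi> s)) =
      (\<Sum>\<psi>\<in>dchars N. - h *\<^sub>R (\<psi> 1 * dser (\<lambda>n. \<psi> n * mangoldt n) s * dser_prod N s))"
    proof (intro sum.cong refl)
      fix \<psi> assume \<psi>: "\<psi> \<in> dchars N"
      have "dser_prod N s = dser \<psi> s * (\<Prod>\<phi>\<in>dchars N - {\<psi>}. dser \<phi> s)"
        unfolding dser_prod_def by (rule prod.remove[OF fin \<psi>])
      then show "h *\<^sub>R (- dser (\<lambda>n. \<psi> n * ln (real n)) s) * (\<Prod>\<phi>\<in>dchars N - {\<psi>}. dser \<phi> s) =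
        - h *\<^sub>R (\<psi> 1 * dser (\<lambda>n. \<psi> n * mangoldt n) s * dser_prod N s)"
        unfolding dser_mangoldt[OF N \<psi> s, symmetric] dcharsD(1)[OF \<psi>] by (simp add: mult_ac)
    qed
    also have "\<dots> = - h *\<^sub>R ((\<Sum>\<psi>\<in>dchars N. \<psi> 1 * dser (\<lambda>n. \<psi> n * mangoldt n) s) * dser_prod N s)"
      unfolding sum_distrib_right scaleR_sum_right ..
    finally show ?thesis
      unfolding sum_dchars_dser_mangoldt[OF N s] by (simp add: scaleR_conv_of_real)
  qed
  ultimately show ?thesis unfolding has_vector_derivative_def by simp
qed

text \<open>The logarithmic derivative of the product is minus a Dirichlet series with nonnegative
  coefficients, because summing over all characters isolates the class of 1.\<close>

lemma norm_dser_prod_decreasing: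
  assumes N: "N > 0" and s: "1 < s" "s \<le> t"
  shows "norm (dser_prod N t) \<le> norm (dser_prod N s)"
proof -
  \<comment> \<open>The squared norm is a bilinear expression, so it can be differentiated
    directly.\<close>
  have "dser_prod N t \<bullet> dser_prod N t \<le> dser_prod N s \<bullet> dser_prod N s"
  proof (rule DERIV_nonpos_imp_nonincreasing[OF s(2)])
    fix x assume "s \<le> x" "x \<le> t"
    then have x: "x > 1" using s by simp
    let ?c = "real (card (dchars N)) * mangoldt_cong N 1 x"
    have "((\<lambda>x. dser_prod N x \<bullet> dser_prod N x) has_vector_derivative
        dser_prod N x \<bullet> (- ?c *\<^sub>R dser_prod N x) + (- ?c *\<^sub>R dser_prod N x) \<bullet> dser_prod N x) (at x)"
      by (intro bounded_bilinear.has_vector_derivative[OF bounded_bilinear_inner]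
          dser_prod_has_vector_derivative N x)
    moreover have "dser_prod N x \<bullet> (- ?c *\<^sub>R dser_prod N x) + (- ?c *\<^sub>R dser_prod N x) \<bullet> dser_prod N x
        = - (2 * ?c * (dser_prod N x \<bullet> dser_prod N x))" by simp
    moreover have "0 \<le> 2 * ?c * (dser_prod N x \<bullet> dser_prod N x)"
      using mangoldt_cong_nonneg[OF x] by (intro mult_nonneg_nonneg) auto
    ultimately show "\<exists>y. ((\<lambda>x. dser_prod N x \<bullet> dser_prod N x) has_real_derivative y) (at x) \<and> y \<le> 0"
      by (auto simp: has_real_derivative_iff_has_vector_derivative intro!: exI)
  qed
  then show ?thesis by (simp add: norm_eq_sqrt_inner)
qed

text \<open>The terms with \<open>n \<ge> 2\<close> are dominated by the telescoping
  \<open>1 / (2 * (n - 1) * n)\<close>, so together they are at most 1/2 and cannot cancel the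
  leading 1. The point 3 serves as the reference at which the product is known not to
  vanish.\<close>

lemma dser_3_nonzero:
  assumes "N > 0" "\<psi> \<in> dchars N"
  shows "dser \<psi> 3 \<noteq> 0"
proof -
  let ?f = "\<lambda>n. \<psi> n * of_real (real n powr (- 3))"
  have le: "norm (?f (n + 2)) \<le> (1 / real (Suc n) - 1 / real (Suc (Suc n))) / 2" for n
  proof -
    have cube: "2 * (real n + 1) * (real n + 2) \<le> real (n + 2) ^ 3"
      by (simp add: power3_eq_cube algebra_simps)
    have "norm (?f (n + 2)) \<le> 1 * real (n + 2) powr (- 3)"
      unfolding norm_mult by (intro mult_mono norm_dchars_le[OF assms]) auto
    also have "1 * real (n + 2) powr (- 3) = 1 / real (n + 2) ^ 3"
      by (simp add: powr_minus_divide powr_numeral)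
    also have "\<dots> \<le> 1 / (2 * (real n + 1) * (real n + 2))"
      using cube by (intro divide_left_mono) auto
    also have "\<dots> = (1 / real (Suc n) - 1 / real (Suc (Suc n))) / 2"
      by (simp add: field_simps)
    finally show ?thesis .
  qed
  have "(\<lambda>n. 1 / real (Suc n)) \<longlonglongrightarrow> 0" by real_asymp
  from telescope_sums'[OF this]
  have tele: "(\<lambda>n. (1 / real (Suc n) - 1 / real (Suc (Suc n))) / 2) sums ((1 / real (Suc 0) - 0) / 2)"
    by (rule sums_divide)
  have "(\<lambda>n. ?f n) sums dser \<psi> 3"
    using dser_sums[OF log_bounded_dchars(1)[OF assms], of 3] by simp
  then have "(\<lambda>n. ?f (n + 2)) sums (dser \<psi> 3 - (\<Sum>n<2. ?f n))"
    by (rule sums_split_initial_segment)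
  \<comment> \<open>The two removed terms are 0 and 1, since
    \<open>0 powr (- 3) = 0\<close>.\<close>
  then have sums: "(\<lambda>n. ?f (n + 2)) sums (dser \<psi> 3 - 1)"
    using dcharsD(1)[OF assms(2)] by (simp add: numeral_2_eq_2)
  have "norm (\<Sum>n. ?f (n + 2)) \<le> (\<Sum>n. (1 / real (Suc n) - 1 / real (Suc (Suc n))) / 2)"
    using le by (intro norm_suminf_le sums_summable[OF tele])
  then have "norm (dser \<psi> 3 - 1) \<le> 1 / 2" using sums tele by (simp add: sums_iff)
  then show ?thesis by auto
qed

lemma dser_prod_3_nonzero: "N > 0 \<Longrightarrow> dser_prod N 3 \<noteq> 0"
  using dser_3_nonzero finite_dchars by (simp add: dser_prod_def)

text \<open>Mean value theorem for the power \<open>1 - s\<close>: an integral comparison in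
  discrete form.\<close>

lemma powr_telescope:
  assumes s: "s > 1" and n: "n > 0"
  shows "(s - 1) * real (Suc n) powr (- s) \<le> real n powr (1 - s) - real (Suc n) powr (1 - s)"
proof -
  have "\<exists>z>real n. z < real (Suc n) \<and>
     real (Suc n) powr (1 - s) - real n powr (1 - s) = (real (Suc n) - real n) * ((1 - s) * z powr (1 - s - 1))"
    by (rule MVT2) (use n has_real_derivative_powr[of _ "1 - s"] in auto)
  then obtain z where z: "z > real n" "z < real (Suc n)"
    "real (Suc n) powr (1 - s) - real n powr (1 - s) = (1 - s) * z powr (- s)" by auto
  have "(s - 1) * real (Suc n) powr (- s) \<le> (s - 1) * z powr (- s)"
    using z s n by (intro mult_left_mono powr_mono2') auto
  then show ?thesis using z(3) by (simp add: algebra_simps)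
qed

text \<open>The telescoped tail contributes at most \<open>1 / (s - 1)\<close>, and for
  \<open>s \<le> 2\<close> so does the leading 1. For the principal character this says that the
  pole at 1 is at most simple.\<close>

lemma norm_dser_le:
  assumes N: "N > 0" "\<psi> \<in> dchars N" and s: "s > 1" "s \<le> 2"
  shows "norm (dser \<psi> s) \<le> 2 / (s - 1)"
proof -
  let ?f = "\<lambda>n. \<psi> n * of_real (real n powr (- s))"
  have le: "norm (?f (n + 2)) \<le> (real (Suc n) powr (1 - s) - real (Suc (Suc n)) powr (1 - s)) / (s - 1)" for n
  proof -
    have "norm (?f (n + 2)) \<le> 1 * real (n + 2) powr (- s)"
      unfolding norm_mult by (intro mult_mono norm_dchars_le[OF N]) auto
    also have "\<dots> = (s - 1) * real (Suc (Suc n)) powr (- s) / (s - 1)" using s by simp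
    also have "\<dots> \<le> (real (Suc n) powr (1 - s) - real (Suc (Suc n)) powr (1 - s)) / (s - 1)"
      using s by (intro divide_right_mono powr_telescope) auto
    finally show ?thesis .
  qed
  have "(\<lambda>n. real (Suc n) powr (1 - s)) \<longlonglongrightarrow> 0" using s by real_asymp
  from telescope_sums'[OF this]
  have tele: "(\<lambda>n. (real (Suc n) powr (1 - s) - real (Suc (Suc n)) powr (1 - s)) / (s - 1)) sums
     ((real (Suc 0) powr (1 - s) - 0) / (s - 1))"
    by (rule sums_divide)
  have "(\<lambda>n. ?f n) sums dser \<psi> s"
    using dser_sums[OF log_bounded_dchars(1)[OF N], of s] s by simp
  then have "(\<lambda>n. ?f (n + 2)) sums (dser \<psi> s - (\<Sum>n<2. ?f n))"
    by (rule sums_split_initial_segment)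
  then have sums: "(\<lambda>n. ?f (n + 2)) sums (dser \<psi> s - 1)"
    using dcharsD(1)[OF N(2)] by (simp add: numeral_2_eq_2)
  have "norm (\<Sum>n. ?f (n + 2)) \<le> (\<Sum>n. (real (Suc n) powr (1 - s) - real (Suc (Suc n)) powr (1 - s)) / (s - 1))"
    using le by (intro norm_suminf_le sums_summable[OF tele])
  then have "norm (dser \<psi> s - 1) \<le> 1 / (s - 1)" using sums tele by (simp add: sums_iff)
  then have "norm (dser \<psi> s) \<le> 1 + 1 / (s - 1)"
    using norm_triangle_ineq[of 1 "dser \<psi> s - 1"] by simp
  also have "1 \<le> 1 / (s - 1)" using s by simp
  then have "1 + 1 / (s - 1) \<le> 1 / (s - 1) + 1 / (s - 1)" by simp
  also have "\<dots> = 2 / (s - 1)" by simp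
  finally show ?thesis .
qed

lemma dser_nonprincipal_bounded:
  assumes N: "N > 0" and \<psi>: "\<psi> \<in> dchars N" "\<psi> \<noteq> principal_char N"
  shows "\<exists>B. \<forall>s. 1 < s \<and> s \<le> 2 \<longrightarrow> norm (dser \<psi> s) \<le> B"
proof -
  obtain C where C: "C > 0" "\<And>s. s > 1 \<Longrightarrow> norm (dser \<psi> s - dser \<psi> 1) \<le> C * (s - 1)"
    using dser_nonprincipal_Lipschitz[OF N \<psi>] by blast
  have "norm (dser \<psi> s) \<le> C + norm (dser \<psi> 1)" if s: "1 < s" "s \<le> 2" for s
  proof -
    have "C * (s - 1) \<le> C * 1" using C(1) s by (intro mult_left_mono) auto
    then show ?thesis
      using C(2)[OF s(1)] norm_triangle_ineq[of "dser \<psi> s - dser \<psi> 1" "dser \<psi> 1"] by simp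
  qed
  then show ?thesis by blast
qed

lemma dser_cnj_1:
  assumes N: "N > 0" and \<psi>: "\<psi> \<in> dchars N" "\<psi> \<noteq> principal_char N"
  shows "dser (\<lambda>n. cnj (\<psi> n)) 1 = cnj (dser \<psi> 1)"
proof -
  have "(\<lambda>n. cnj (\<psi> n * of_real (real n powr (- 1)))) sums cnj (dser \<psi> 1)"
    using dser_nonprincipal_sums[OF N \<psi>, of 1] by (subst sums_cnj) simp
  then show ?thesis by (simp add: dser_def sums_iff)
qed

lemma dser_complex_char_nonzero:
  assumes N: "N > 0" and \<psi>: "\<psi> \<in> dchars N" "\<psi> \<noteq> principal_char N"
    and nonreal: "(\<lambda>n. cnj (\<psi> n)) \<noteq> \<psi>"
  shows "dser \<psi> 1 \<noteq> 0"
proof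
  \<comment> \<open>The two zeros at \<open>\<psi>\<close> and its conjugate outweigh the simple pole of the principal factor,
      so the product would tend to 0 as \<open>s\<close> decreases to 1, although its modulus increases.\<close>
  assume zero: "dser \<psi> 1 = 0"
  define \<phi> where "\<phi> n = cnj (\<psi> n)" for n
  have \<phi>: "\<phi> \<in> dchars N" "\<phi> \<noteq> \<psi>"
    using dchars_cnj[OF \<psi>(1)] nonreal by (auto simp: \<phi>_def[abs_def])
  have "\<phi> \<noteq> principal_char N"
  proof
    assume "\<phi> = principal_char N"
    then have "cnj (\<psi> n) = principal_char N n" for n by (metis \<phi>_def)
    then have "\<psi> n = principal_char N n" for n
      by (metis complex_cnj_cnj complex_cnj_one complex_cnj_zero principal_char_def)
    then show False using \<psi>(2) by blast
  qed
  note \<phi> = \<phi> this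
  have zero': "dser \<phi> 1 = 0"
    using dser_cnj_1[OF N \<psi>] zero by (simp add: \<phi>_def[abs_def])
  obtain C where C: "C > 0" "\<And>s. s > 1 \<Longrightarrow> norm (dser \<psi> s) \<le> C * (s - 1)"
    using dser_nonprincipal_Lipschitz[OF N \<psi>] zero by (metis diff_zero)
  obtain D where D: "D > 0" "\<And>s. s > 1 \<Longrightarrow> norm (dser \<phi> s) \<le> D * (s - 1)"
    using dser_nonprincipal_Lipschitz[OF N \<phi>(1,3)] zero' by (metis diff_zero)
  define R where "R = dchars N - {principal_char N} - {\<psi>} - {\<phi>}"
  obtain B where B: "\<And>\<xi> s. \<xi> \<in> R \<Longrightarrow> 1 < s \<Longrightarrow> s \<le> 2 \<Longrightarrow> norm (dser \<xi> s) \<le> B \<xi>"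
    using dser_nonprincipal_bounded[OF N] unfolding R_def by (metis DiffD1 DiffD2 singletonI)
  define K where "K = 2 * C * D * (\<Prod>\<xi>\<in>R. \<bar>B \<xi>\<bar>)"
  have "K \<ge> 0" using C D by (auto simp: K_def intro!: mult_nonneg_nonneg prod_nonneg)
  have bound: "norm (dser_prod N 3) \<le> K * (s - 1)" if s: "1 < s" "s \<le> 2" for s
  proof -
    have eq: "dser_prod N s = dser (principal_char N) s * (dser \<psi> s * (dser \<phi> s * (\<Prod>\<xi>\<in>R. dser \<xi> s)))"
      unfolding dser_prod_def R_def using finite_dchars[OF N] \<psi> \<phi>
      by (simp add: prod.remove[of _ "principal_char N"] prod.remove[of _ \<psi>] prod.remove[of _ \<phi>])
    have R: "norm (\<Prod>\<xi>\<in>R. dser \<xi> s) \<le> (\<Prod>\<xi>\<in>R. \<bar>B \<xi>\<bar>)"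
      unfolding prod_norm[symmetric] using B[OF _ s] by (intro prod_mono) (auto intro: order_trans[OF _ abs_ge_self])
    have "norm (dser_prod N s) \<le> 2 / (s - 1) * (C * (s - 1) * (D * (s - 1) * (\<Prod>\<xi>\<in>R. \<bar>B \<xi>\<bar>)))"
      unfolding eq norm_mult
      by (intro mult_mono norm_dser_le[OF N principal_char_in_dchars s] C(2) D(2) R s(1)
          mult_nonneg_nonneg prod_nonneg norm_ge_zero)
        (use C(1) D(1) s in auto)
    also have "\<dots> = K * (s - 1)" using s by (simp add: K_def field_simps)
    finally show ?thesis using norm_dser_prod_decreasing[OF N s(1), of 3] s by simp
  qed
  \<comment> \<open>So close to 1 that \<open>K * (s - 1)\<close> drops below the fixed norm at 3.
    The minimum keeps \<open>s \<le> 2\<close>, and \<open>K + 1\<close> keeps the denominator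
    positive.\<close>
  define s where "s = 1 + min 1 (norm (dser_prod N 3) / (2 * (K + 1)))"
  have pos: "norm (dser_prod N 3) > 0" using dser_prod_3_nonzero[OF N] by simp
  have "1 < s" "s \<le> 2" using pos \<open>K \<ge> 0\<close> by (auto simp: s_def)
  then have "norm (dser_prod N 3) \<le> K * (s - 1)" by (rule bound)
  also have "\<dots> \<le> K * (norm (dser_prod N 3) / (2 * (K + 1)))"
    using \<open>K \<ge> 0\<close> by (intro mult_left_mono) (auto simp: s_def)
  also have "\<dots> = norm (dser_prod N 3) * (K / (2 * (K + 1)))" by simp
  also have "\<dots> < norm (dser_prod N 3) * 1"
    using pos \<open>K \<ge> 0\<close> by (intro mult_strict_left_mono) (auto simp: divide_simps)
  finally show False by simp
qed

theorem dser_nonprincipal_nonzero: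
  assumes "N > 0" "\<psi> \<in> dchars N" "\<psi> \<noteq> principal_char N"
  shows "dser \<psi> 1 \<noteq> 0"
  using dser_complex_char_nonzero[OF assms] dser_real_char_nonzero[OF assms] by metis

section \<open>Primes in arithmetic progressions\<close>

text \<open>In \<open>F = - L' / L\<close> the numerator is bounded, and the Lipschitz estimate
  keeps the denominator above half of its nonzero modulus at 1 as long as
  \<open>s - 1 < L / (2 * C)\<close>, with \<open>L\<close> the modulus at 1.\<close>

lemma eventually_dser_mangoldt_nonprincipal_bounded:
  assumes N: "N > 0" and \<psi>: "\<psi> \<in> dchars N" "\<psi> \<noteq> principal_char N"
  shows "\<exists>B. \<forall>\<^sub>F s in at_right 1. norm (dser (\<lambda>n. \<psi> n * mangoldt n) s) \<le> B"
proof -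
  obtain C where C: "C > 0" "\<And>s. s > 1 \<Longrightarrow> norm (dser \<psi> s - dser \<psi> 1) \<le> C * (s - 1)"
    using dser_nonprincipal_Lipschitz[OF N \<psi>] by blast
  obtain D where D: "\<And>s. s > 1 \<Longrightarrow> norm (dser (\<lambda>n. \<psi> n * ln (real n)) s) \<le> D"
    using dser_nonprincipal_deriv_bounded[OF N \<psi>] by blast
  define L where "L = norm (dser \<psi> 1)"
  have L: "L > 0" using dser_nonprincipal_nonzero[OF N \<psi>] by (simp add: L_def)
  have bound: "norm (dser (\<lambda>n. \<psi> n * mangoldt n) s) \<le> D / (L / 2)" if s: "s \<in> {1<..<1 + L / (2 * C)}" for s
  proof -
    have "C * (s - 1) \<le> C * (L / (2 * C))" using s C(1) by (intro mult_left_mono) auto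
    then have "norm (dser \<psi> s - dser \<psi> 1) \<le> L / 2" using C(2)[of s] C(1) s by simp
    then have ge: "norm (dser \<psi> s) \<ge> L / 2"
      using norm_triangle_ineq2[of "dser \<psi> 1" "dser \<psi> s"] by (simp add: L_def norm_minus_commute)
    have "L / 2 * norm (dser (\<lambda>n. \<psi> n * mangoldt n) s) \<le> norm (dser \<psi> s) * norm (dser (\<lambda>n. \<psi> n * mangoldt n) s)"
      using ge by (intro mult_right_mono) auto
    also have "\<dots> \<le> D"
      using D[of s] s dser_mangoldt[OF N \<psi>(1), of s] by (simp flip: norm_mult)
    finally show ?thesis using L by (simp add: field_simps)
  qed
  have "\<forall>\<^sub>F s in at_right 1. s \<in> {1<..<1 + L / (2 * C)}"
    by (rule eventually_at_right_real) (use L C in simp)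
  then have "\<forall>\<^sub>F s in at_right 1. norm (dser (\<lambda>n. \<psi> n * mangoldt n) s) \<le> D / (L / 2)"
    by (rule eventually_mono) (rule bound)
  then show ?thesis by blast
qed

section \<open>The principal character near 1\<close>

definition coprime_zeta :: "nat \<Rightarrow> real \<Rightarrow> real" where
  "coprime_zeta N s = (\<Sum>n. if coprime n N then real n powr (- s) else 0)"

lemma coprime_zeta_sums:
  assumes "s > 1"
  shows "(\<lambda>n. if coprime n N then ln (real n) ^ k * real n powr (- s) else 0) sums
    (\<Sum>n. if coprime n N then ln (real n) ^ k * real n powr (- s) else 0)"
proof (intro summable_sums summable_comparison_test[OF _ summable_ln_power_powr[OF assms]])
  have "ln (real n) \<ge> 0" for n by (cases "n = 0") auto
  then show "\<exists>M. \<forall>n\<ge>M. norm (if coprime n N then ln (real n) ^ k * real n powr (- s) else 0)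
      \<le> ln (real n) ^ k * real n powr (- s)"
    by (auto simp: abs_mult)
qed

text \<open>Comparison with the harmonic series through
  \<open>N * k + 1 \<le> (N + 1) * (k + 1)\<close>.\<close>

lemma sum_arith_prog_unbounded:
  fixes N :: nat and K :: real
  shows "\<exists>R. (\<Sum>k<R. 1 / real (N * k + 1)) > K"
proof (rule ccontr)
  assume "\<not> ?thesis"
  then have le: "(\<Sum>k<R. 1 / real (N * k + 1)) \<le> K" for R by (simp add: not_less)
  have "summable (\<lambda>k. 1 / real (N * k + 1))"
    by (rule summableI_nonneg_bounded[OF _ le]) auto
  then have "summable (\<lambda>k. real (N + 1) * (1 / real (N * k + 1)))" by (rule summable_mult)
  then have "summable (\<lambda>k. 1 / real (Suc k))"
  proof (rule summable_comparison_test'[where N = 0])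
    fix k
    have "N * k + 1 \<le> (N + 1) * Suc k" by simp
    then have "real (N * k + 1) \<le> real (N + 1) * real (Suc k)"
      unfolding of_nat_mult[symmetric] of_nat_le_iff .
    then have "1 / real (Suc k) \<le> real (N + 1) * (1 / real (N * k + 1))"
      by (simp add: divide_simps del: of_nat_Suc)
    then show "norm (1 / real (Suc k)) \<le> real (N + 1) * (1 / real (N * k + 1))" by simp
  qed
  then have "summable (\<lambda>k. 1 / real k)" by (subst (asm) summable_Suc_iff)
  then show False using not_summable_harmonic[where 'a = real] by (simp add: inverse_eq_divide)
qed

text \<open>The numbers \<open>N * k + 1\<close> are coprime to \<open>N\<close>. A finite sum over
  them that exceeds \<open>K\<close> at 1 still does so for nearby \<open>s\<close>, by continuity,
  and it bounds the whole series from below.\<close>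

lemma eventually_coprime_zeta_gt:
  fixes K :: real
  assumes N: "N > 0"
  shows "\<forall>\<^sub>F s in at_right 1. coprime_zeta N s > K"
proof -
  obtain R where R: "(\<Sum>k<R. 1 / real (N * k + 1)) > K" using sum_arith_prog_unbounded by blast
  have "((\<lambda>s. \<Sum>k<R. real (N * k + 1) powr (- s)) \<longlongrightarrow> (\<Sum>k<R. real (N * k + 1) powr (- 1))) (at_right 1)"
    by (intro tendsto_intros) (simp only: of_nat_eq_0_iff, simp)
  moreover have "(\<Sum>k<R. real (N * k + 1) powr (- 1)) > K"
    using R by (simp only: powr_minus_divide powr_one_gt_zero_iff powr_one of_nat_0_le_iff)
  ultimately have "\<forall>\<^sub>F s in at_right 1. (\<Sum>k<R. real (N * k + 1) powr (- s)) > K"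
    by (rule order_tendstoD)
  then show ?thesis
    using eventually_at_right_less
  proof eventually_elim
    case (elim s)
    have sums: "(\<lambda>n. if coprime n N then real n powr (- s) else 0) sums coprime_zeta N s"
      using coprime_zeta_sums[OF elim(2), of N 0] by (simp add: coprime_zeta_def cong: if_cong)
    have "(\<Sum>k<R. real (N * k + 1) powr (- s)) = (\<Sum>n\<in>(\<lambda>k. N * k + 1) ` {..<R}. real n powr (- s))"
      using N by (subst sum.reindex) (auto intro: inj_onI)
    also have "\<dots> = (\<Sum>n\<in>(\<lambda>k. N * k + 1) ` {..<R}. if coprime n N then real n powr (- s) else 0)"
    proof (intro sum.cong refl)
      fix n assume "n \<in> (\<lambda>k. N * k + 1) ` {..<R}"
      then obtain k where "n = N * k + 1" by auto
      then have "coprime n N"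
        by (metis coprime_1_left coprime_commute gcd_add_mult coprime_iff_gcd_eq_1 add.commute mult.commute)
      then show "real n powr (- s) = (if coprime n N then real n powr (- s) else 0)" by simp
    qed
    also have "\<dots> \<le> coprime_zeta N s"
      unfolding coprime_zeta_def by (intro sum_le_suminf sums_summable[OF sums]) auto
    finally show ?case using elim(1) by simp
  qed
qed

lemma eventually_dser_mangoldt_principal_ge:
  assumes N: "N > 0"
  shows "\<forall>\<^sub>F s in at_right 1. Re (dser (\<lambda>n. principal_char N n * mangoldt n) s) \<ge> K"
proof -
  \<comment> \<open>Compare \<open>-L' = \<Sum> ln n / n ^ s\<close> with \<open>(K + 1) L\<close>: only the finitely many \<open>n < M\<close>
      contribute negatively, and \<open>L\<close> tends to infinity as \<open>s\<close> tends to 1.\<close>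
  define M where "M = nat \<lceil>exp (K + 1)\<rceil>"
  have M: "ln (real n) \<ge> K + 1" if "n \<ge> M" for n
  proof -
    have "exp (K + 1) \<le> real n" using that unfolding M_def by linarith
    then show ?thesis by (metis exp_gt_zero exp_le_cancel_iff exp_ln less_le_trans)
  qed
  have "\<forall>\<^sub>F s in at_right 1. coprime_zeta N s > max 1 ((\<bar>K\<bar> + 1) * real M)"
    by (rule eventually_coprime_zeta_gt[OF N])
  then show ?thesis
    using eventually_at_right_less
  proof eventually_elim
    case (elim s)
    define l where "l = coprime_zeta N s"
    define d where "d = (\<Sum>n. if coprime n N then ln (real n) ^ 1 * real n powr (- s) else 0)"
    have l_sums: "(\<lambda>n. if coprime n N then real n powr (- s) else 0) sums l"
      using coprime_zeta_sums[OF elim(2), of N 0] by (simp add: coprime_zeta_def l_def cong: if_cong)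
    have d_sums: "(\<lambda>n. if coprime n N then ln (real n) ^ 1 * real n powr (- s) else 0) sums d"
      unfolding d_def by (rule coprime_zeta_sums[OF elim(2)])
    note lb = log_bounded_dchars[OF N principal_char_in_dchars]
    have "(\<lambda>n. principal_char N n * of_real (real n powr (- s))) sums of_real l"
      using sums_of_real[OF l_sums, where 'a = complex]
      by (rule back_subst[of "\<lambda>f. f sums complex_of_real l"]) (auto simp: principal_char_def)
    then have L: "dser (principal_char N) s = of_real l"
      using dser_sums[OF lb(1) elim(2)] sums_unique2 by blast
    have "(\<lambda>n. principal_char N n * ln (real n) * of_real (real n powr (- s))) sums of_real d"
      using sums_of_real[OF d_sums, where 'a = complex]
      by (rule back_subst[of "\<lambda>f. f sums complex_of_real d"]) (auto simp: principal_char_def)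
    then have D: "dser (\<lambda>n. principal_char N n * ln (real n)) s = of_real d"
      using dser_sums[OF lb(3) elim(2)] sums_unique2 by blast
    have l: "l > 1" "l > (\<bar>K\<bar> + 1) * real M" using elim(1) by (auto simp: l_def)
    have "of_real l * dser (\<lambda>n. principal_char N n * mangoldt n) s = of_real d"
      using dser_mangoldt[OF N principal_char_in_dchars elim(2)] L D by simp
    then have "Re (of_real l * dser (\<lambda>n. principal_char N n * mangoldt n) s) = d" by simp
    then have F: "l * Re (dser (\<lambda>n. principal_char N n * mangoldt n) s) = d" by simp
    have g: "(\<lambda>n. (if coprime n N then ln (real n) ^ 1 * real n powr (- s) else 0) -
        (K + 1) * (if coprime n N then real n powr (- s) else 0)) sums (d - (K + 1) * l)"
      by (intro sums_diff sums_mult d_sums l_sums)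
    \<comment> \<open>Each term below \<open>M\<close> costs at most
      \<open>\<bar>K\<bar> + 1\<close>. The total is less than \<open>l\<close> by the threshold
      imposed on \<open>coprime_zeta\<close>, so it uses up just one of the \<open>K + 1\<close>
      copies of \<open>l\<close>.\<close>
    have f: "(\<lambda>n. if n \<in> {..<M} then - (\<bar>K\<bar> + 1) else 0) sums (\<Sum>n<M. - (\<bar>K\<bar> + 1))"
      by (rule sums_If_finite_set) simp
    have le: "(if n \<in> {..<M} then - (\<bar>K\<bar> + 1) else 0) \<le>
      (if coprime n N then ln (real n) ^ 1 * real n powr (- s) else 0) -
        (K + 1) * (if coprime n N then real n powr (- s) else 0)" for n
    proof -
      have ln0: "ln (real n) \<ge> 0" by (cases "n = 0") auto
      have le1: "real n powr (- s) \<le> 1"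
        using elim(2) powr_mono[of "- s" 0 "real n"] by (cases "n = 0") auto
      have "0 \<le> ln (real n) * real n powr (- s)" using ln0 by simp
      moreover have "(K + 1) * real n powr (- s) \<le> (\<bar>K\<bar> + 1) * 1"
        using le1 by (intro mult_mono) auto
      moreover have "(K + 1) * real n powr (- s) \<le> ln (real n) * real n powr (- s)" if "n \<ge> M"
        using M[OF that] by (intro mult_right_mono) auto
      ultimately show ?thesis by (auto simp: not_less)
    qed
    have "(\<Sum>n<M. - (\<bar>K\<bar> + 1)) \<le> d - (K + 1) * l"
      using le f g by (rule sums_le)
    then have "d \<ge> (K + 1) * l - (\<bar>K\<bar> + 1) * real M" by (simp add: algebra_simps)
    then have "d \<ge> K * l" using l(2) by (simp add: algebra_simps)
    then have "l * K \<le> l * Re (dser (\<lambda>n. principal_char N n * mangoldt n) s)" using F by (simp add: mult.commute)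
    then show "K \<le> Re (dser (\<lambda>n. principal_char N n * mangoldt n) s)" using l(1) by simp
  qed
qed

text \<open>Coprimality of \<open>b\<close> gives the principal term weight 1, so it outgrows the
  bounded remaining terms; its threshold \<open>c * K\<close> plus the sum of the \<open>B\<close>
  leaves \<open>c * K\<close> after their loss.\<close>

lemma eventually_mangoldt_cong_ge:
  assumes N: "N > 0" and b: "coprime b N"
  shows "\<forall>\<^sub>F s in at_right 1. mangoldt_cong N b s \<ge> K"
proof -
  let ?X = "dchars N - {principal_char N}"
  define c where "c = real (card (dchars N))"
  have c: "c > 0" using card_dchars_pos[OF N] by (simp add: c_def)
  obtain B where B: "\<And>\<psi>. \<psi> \<in> ?X \<Longrightarrow> \<forall>\<^sub>F s in at_right 1. norm (dser (\<lambda>n. \<psi> n * mangoldt n) s) \<le> B \<psi>"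
    using eventually_dser_mangoldt_nonprincipal_bounded[OF N] by (metis DiffD1 DiffD2 singletonI)
  have "\<forall>\<^sub>F s in at_right 1. \<forall>\<psi>\<in>?X. norm (dser (\<lambda>n. \<psi> n * mangoldt n) s) \<le> B \<psi>"
    using B finite_dchars[OF N] by (intro eventually_ball_finite) auto
  moreover have "\<forall>\<^sub>F s in at_right 1. Re (dser (\<lambda>n. principal_char N n * mangoldt n) s) \<ge> c * K + (\<Sum>\<psi>\<in>?X. B \<psi>)"
    by (rule eventually_dser_mangoldt_principal_ge[OF N])
  ultimately show ?thesis
    using eventually_at_right_less
  proof eventually_elim
    case (elim s)
    have "complex_of_real (c * mangoldt_cong N b s) = (\<Sum>\<psi>\<in>dchars N. \<psi> b * dser (\<lambda>n. \<psi> n * mangoldt n) s)"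
      using sum_dchars_dser_mangoldt[OF N elim(3), of b] by (simp add: c_def)
    also have "\<dots> = principal_char N b * dser (\<lambda>n. principal_char N n * mangoldt n) s +
        (\<Sum>\<psi>\<in>?X. \<psi> b * dser (\<lambda>n. \<psi> n * mangoldt n) s)"
      by (rule sum.remove) (use finite_dchars[OF N] in auto)
    finally have "Re (complex_of_real (c * mangoldt_cong N b s)) =
      Re (principal_char N b * dser (\<lambda>n. principal_char N n * mangoldt n) s +
        (\<Sum>\<psi>\<in>?X. \<psi> b * dser (\<lambda>n. \<psi> n * mangoldt n) s))" by (rule arg_cong)
    then have eq: "c * mangoldt_cong N b s = Re (dser (\<lambda>n. principal_char N n * mangoldt n) s) +
        Re (\<Sum>\<psi>\<in>?X. \<psi> b * dser (\<lambda>n. \<psi> n * mangoldt n) s)"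
      using b by (simp add: principal_char_def)
    have "norm (\<Sum>\<psi>\<in>?X. \<psi> b * dser (\<lambda>n. \<psi> n * mangoldt n) s) \<le> (\<Sum>\<psi>\<in>?X. B \<psi>)"
    proof (rule sum_norm_le)
      fix \<psi> assume \<psi>: "\<psi> \<in> ?X"
      have "norm (\<psi> b * dser (\<lambda>n. \<psi> n * mangoldt n) s) \<le> 1 * B \<psi>"
        unfolding norm_mult using elim(1) \<psi> by (intro mult_mono norm_dchars_le[OF N]) auto
      then show "norm (\<psi> b * dser (\<lambda>n. \<psi> n * mangoldt n) s) \<le> B \<psi>" by simp
    qed
    then have "Re (\<Sum>\<psi>\<in>?X. \<psi> b * dser (\<lambda>n. \<psi> n * mangoldt n) s) \<ge> - (\<Sum>\<psi>\<in>?X. B \<psi>)"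
      using abs_Re_le_cmod[of "\<Sum>\<psi>\<in>?X. \<psi> b * dser (\<lambda>n. \<psi> n * mangoldt n) s"] by linarith
    then have "c * K \<le> c * mangoldt_cong N b s" using eq elim(2) by linarith
    then show "K \<le> mangoldt_cong N b s" using c by simp
  qed
qed

text \<open>For each prime the exponents from 2 on form a geometric series of ratio at most 1/2,
  with sum at most \<open>2 * ln p / p ^ 2\<close>. The exponent 1 of \<open>n\<close> in the terms
  gives a majorant valid for all \<open>s > 1\<close>.\<close>

lemma summable_mangoldt_nonprime:
  "summable (\<lambda>n. if prime n then 0 else mangoldt n / real n)"
proof (rule summableI_nonneg_bounded)
  let ?h = "\<lambda>n. if prime n then 0 else mangoldt n / real n :: real"
  have h0: "?h n \<ge> 0" for n by (simp add: mangoldt_nonneg)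
  then show "0 \<le> ?h n" for n .
  have ln0: "ln (real n) \<ge> 0" for n by (cases "n = 0") auto
  have sm: "summable (\<lambda>n. 2 * (ln (real n) ^ 1 * real n powr (- 2)))"
    by (intro summable_mult summable_ln_power_powr) simp
  fix M :: nat
  \<comment> \<open>The nonprime prime powers below \<open>M\<close> all have the form
    \<open>p ^ (k + 2)\<close> with \<open>p\<close> and \<open>k\<close> below \<open>M\<close>.
    Enlarging the sum to this full box makes it factor.\<close>
  define D where "D = {p. prime p \<and> p < M} \<times> {..<M}"
  define g where "g = (\<lambda>(p, k). p ^ (k + 2) :: nat)"
  have finD: "finite D"
    unfolding D_def by (intro finite_cartesian_product finite_subset[of "{p. prime p \<and> p < M}" "{..<M}"]) auto
  have "(\<Sum>n<M. ?h n) \<le> (\<Sum>n\<in>g ` D. ?h n)"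
  proof -
    have "n \<in> g ` D" if n: "n < M" "?h n \<noteq> 0" for n
    proof -
      have "\<not> prime n" "mangoldt n \<noteq> (0::real)" using n(2) by (auto split: if_splits)
      then obtain p k where pk: "prime p" "k > 0" "n = p ^ k"
        by (auto simp: mangoldt_def primepow_def split: if_splits)
      then have "k \<noteq> 1" using \<open>\<not> prime n\<close> by auto
      then have "k - 2 + 2 = k" using pk(2) by simp
      then have k: "n = g (p, k - 2)" using pk(3) by (simp only: g_def prod.case)
      have "p ^ 1 \<le> p ^ k" using pk(2) prime_ge_1_nat[OF pk(1)] by (intro power_increasing) auto
      then have "p < M" using pk(3) n(1) by simp
      moreover have "k < p ^ k" using power_gt_expt[of p k] prime_gt_1_nat[OF pk(1)] by simp
      ultimately have "(p, k - 2) \<in> D" using pk n(1) by (simp add: D_def)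
      then show ?thesis using k by blast
    qed
    then have "(\<Sum>n | n < M \<and> ?h n \<noteq> 0. ?h n) \<le> (\<Sum>n\<in>g ` D. ?h n)"
      using finD h0 by (intro sum_mono2) auto
    moreover have "(\<Sum>n | n < M \<and> ?h n \<noteq> 0. ?h n) = (\<Sum>n<M. ?h n)"
      by (intro sum.mono_neutral_left) auto
    ultimately show ?thesis by simp
  qed
  also have "\<dots> \<le> (\<Sum>pk\<in>D. ?h (g pk))"
    using sum_image_le[of D ?h g] finD h0 by (simp add: comp_def)
  also have "\<dots> \<le> (\<Sum>pk\<in>D. case pk of (p, k) \<Rightarrow> ln (real p) / real p ^ 2 * (1 / 2) ^ k)"
  proof (rule sum_mono)
    fix pk assume "pk \<in> D"
    then obtain p k where pk: "pk = (p, k)" "prime p" by (auto simp: D_def)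
    have "?h (g pk) \<le> ln (real p) / real p ^ (k + 2)"
      using pk h0 ln0[of p] by (auto simp: g_def mangoldt_primepow simp del: power_add power_Suc)
    also have "\<dots> = ln (real p) / real p ^ 2 * (1 / real p) ^ k"
      by (simp add: power_add power_one_over power2_eq_square)
    also have "\<dots> \<le> ln (real p) / real p ^ 2 * (1 / 2) ^ k"
      using prime_ge_2_nat[OF pk(2)] ln0[of p]
      by (intro mult_left_mono power_mono divide_left_mono divide_nonneg_nonneg) auto
    finally show "?h (g pk) \<le> (case pk of (p, k) \<Rightarrow> ln (real p) / real p ^ 2 * (1 / 2) ^ k)" using pk by simp
  qed
  also have "\<dots> = (\<Sum>p | prime p \<and> p < M. ln (real p) / real p ^ 2) * (\<Sum>k<M. (1 / 2) ^ k)"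
    unfolding D_def sum_product sum.cartesian_product ..
  also have "\<dots> \<le> (\<Sum>p | prime p \<and> p < M. ln (real p) / real p ^ 2) * 2"
  proof (intro mult_left_mono sum_nonneg)
    have "(\<Sum>k<M. (1 / 2) ^ k) = 2 - 2 * (1 / 2 :: real) ^ M" by (induction M) auto
    then show "(\<Sum>k<M. (1 / 2) ^ k) \<le> (2 :: real)" by simp
  qed (use ln0 in auto)
  also have "\<dots> = (\<Sum>p | prime p \<and> p < M. 2 * (ln (real p) ^ 1 * real p powr (- 2)))"
    unfolding sum_distrib_right
    by (intro sum.cong refl) (auto simp: powr_minus_divide prime_gt_0_nat)
  also have "\<dots> \<le> (\<Sum>n. 2 * (ln (real n) ^ 1 * real n powr (- 2)))"
    using ln0 by (intro sum_le_suminf sm) auto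
  finally show "(\<Sum>n<M. ?h n) \<le> (\<Sum>n. 2 * (ln (real n) ^ 1 * real n powr (- 2)))" .
qed

text \<open>With finitely many such primes, \<open>mangoldt_cong\<close> would stay below one
  constant for all \<open>s > 1\<close>, although it is unbounded near 1.\<close>

theorem infinite_primes_cong_nat:
  fixes N b :: nat
  assumes N: "N > 0" and b: "coprime b N"
  shows "infinite {p. prime p \<and> [b * p = 1] (mod N)}"
proof
  let ?P = "{p. prime p \<and> [b * p = 1] (mod N)}"
  assume fin: "finite ?P"
  let ?h = "\<lambda>n. if prime n then 0 else mangoldt n / real n :: real"
  \<comment> \<open>Primes of the class contribute at most \<open>ln p\<close> each, and the other
    prime powers at most their sum at \<open>s = 1\<close>.\<close>
  define K where "K = (\<Sum>p\<in>?P. ln (real p)) + (\<Sum>n. ?h n)"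
  have "\<forall>\<^sub>F s in at_right 1. mangoldt_cong N b s \<ge> K + 1 \<and> 1 < s"
    by (intro eventually_conj eventually_mangoldt_cong_ge eventually_at_right_less N b)
  then obtain s where s: "mangoldt_cong N b s \<ge> K + 1" "s > 1"
    using eventually_happens' trivial_limit_at_right_real by (metis (no_types, lifting))
  have "(\<lambda>n. if n \<in> ?P then ln (real n) else 0) sums (\<Sum>p\<in>?P. ln (real p))"
    using fin by (rule sums_If_finite_set)
  then have g: "(\<lambda>n. (if n \<in> ?P then ln (real n) else 0) + ?h n) sums K"
    unfolding K_def by (intro sums_add summable_sums summable_mangoldt_nonprime)
  have f: "(\<lambda>n. if [b * n = 1] (mod N) then mangoldt n * real n powr (- s) else 0) sums mangoldt_cong N b s"
    unfolding mangoldt_cong_def by (intro summable_sums summable_mangoldt_cong s)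
  have le: "(if [b * n = 1] (mod N) then mangoldt n * real n powr (- s) else 0) \<le>
      (if n \<in> ?P then ln (real n) else 0) + ?h n" for n
  proof (cases "n = 0")
    case False
    have "real n powr (- s) \<le> real n powr (- 1)" using False s by (intro powr_mono) auto
    then have "mangoldt n * real n powr (- s) \<le> mangoldt n * (1 / real n)"
      using mangoldt_nonneg[of n] by (intro mult_left_mono) (auto simp: powr_minus_divide)
    moreover have "mangoldt n * (1 / real n) \<le> mangoldt n"
      using mangoldt_nonneg[of n] False by (simp add: divide_le_eq mult_le_cancel_left1)
    ultimately show ?thesis
      by (cases "prime n") (simp_all add: mangoldt_nonneg)
  qed simp
  have "mangoldt_cong N b s \<le> K" using le f g by (rule sums_le)
  then show False using s by simp
qed

text \<open>Let \<open>b\<close> be an inverse of the residue \<open>a\<close> of \<open>A\<close>.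
  Multiplying \<open>b * p\<close> congruent to 1 by \<open>a\<close> turns it into \<open>p\<close>
  congruent to \<open>a\<close>.\<close>

lemma infinite_primes_cong_int:
  fixes N A :: int
  assumes N: "N > 0" and A: "gcd A N = 1"
  shows "infinite {p::int. prime p \<and> [p = A] (mod N)}"
proof -
  define n where "n = nat N"
  have n: "n > 0" "N = int n" using N by (auto simp: n_def)
  define a where "a = nat (A mod N)"
  have a: "int a = A mod N" using N by (simp add: a_def)
  have "gcd (int a) (int n) = 1" using A N by (simp add: a flip: n(2))
  then have "coprime (int a) (int n)" by (simp only: coprime_iff_gcd_eq_1)
  then have "coprime a n" by simp
  from cong_solve_coprime_nat[OF this] obtain b where b: "[a * b = 1] (mod n)" by auto
  then have "coprime b n"
    by (metis coprime_1_left coprime_mult_left_iff cong_imp_coprime cong_sym)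
  then have inf: "infinite {p. prime p \<and> [b * p = 1] (mod n)}"
    by (rule infinite_primes_cong_nat[OF n(1)])
  have "int ` {p. prime p \<and> [b * p = 1] (mod n)} \<subseteq> {p::int. prime p \<and> [p = A] (mod N)}"
  proof (clarify, intro conjI)
    fix p :: nat assume p: "prime p" "[b * p = 1] (mod n)"
    then show "prime (int p)" by simp
    have "[a * (b * p) = a * 1] (mod n)" using p(2) by (intro cong_mult) auto
    moreover have "[a * b * p = 1 * p] (mod n)" using b by (intro cong_mult) auto
    ultimately have "[p = a] (mod n)"
      by (simp add: mult.assoc) (metis cong_sym cong_trans)
    then have "[int p = int a] (mod int n)" by (simp add: cong_int_iff)
    then show "[int p = A] (mod N)" by (simp add: a n(2) Cong.cong_def)
  qed
  moreover have "infinite (int ` {p. prime p \<and> [b * p = 1] (mod n)})"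
    using inf by (simp add: finite_image_iff)
  ultimately show ?thesis using finite_subset by blast
qed

lemma infinite_countable_eqpoll:
  fixes A :: "'a::countable set" and B :: "'b::countable set"
  assumes "infinite A" "infinite B"
  shows "A \<approx> B"
proof -
  obtain f where "bij_betw f A (UNIV :: nat set)"
    using countableE_infinite[OF countableI_type assms(1)] by blast
  moreover obtain g where "bij_betw g B (UNIV :: nat set)"
    using countableE_infinite[OF countableI_type assms(2)] by blast
  ultimately show ?thesis
    by (meson bij_betw_inv_into bij_betw_trans eqpoll_def)
qed

theorem theorem1:
  fixes N A :: int
  assumes "N > 0" and "gcd A N = 1"
  shows "{p::int. prime p \<and> N dvd (p - A)} \<approx> {n::int. n > 0}
       \<and> infinite {p::int. prime p \<and> [p = A] (mod N)}"
proof -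
  have "infinite {p::int. prime p \<and> [p = A] (mod N)}"
    using assms by (rule infinite_primes_cong_int)
  moreover have "infinite {n::int. n > 0}"
    using infinite_Ioi[of "0::int"] by (simp add: greaterThan_def)
  ultimately show ?thesis
    using infinite_countable_eqpoll by (simp add: cong_iff_dvd_diff)
qed

end
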